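(* Let $H$ be a semisimple Hopf algebra over an algebraically closed field $k$ of characteristic $0$. If $H$ is nilpotent, then $H$ is solvable.
   Context: A left coideal subalgebra of $H$ is a unital subalgebra $N$ with $\Delta(N)\subset H\otimes N$. The left adjoint action is $a\,_{\dot{ad}}\,b=\sum a_1bS(a_2)$; $N$ is normal if it is stable under it, and then $H//N=H/HN^+$ is a Hopf quotient, $N^+=N\cap\ker\varepsilon$. Every left coideal subalgebra $N$ has a unique idempotent two-sided integral $\Lambda_N\in N$: $n\Lambda_N=\Lambda_Nn=\langle\varepsilon,n\rangle\Lambda_N$ for $n\in N$, $\langle\varepsilon,\Lambda_N\rangle=1$. Nilpotency: let $\tilde Z(H)$ be the Hopf center of $H$ (the maximal Hopf subalgebra contained in the center of $H$). Put $H_0=H$ and $H_i=H_{i-1}//\tilde Z(H_{i-1})$ for $i\ge1$, let $\pi_i:H\to H_i$ be the composed projection and $Z_i=H^{co\,\pi_i}=\{h\in H:\sum h_1\otimes\pi_i(h_2)=h\otimes 1\}$, so that $k=Z_0\subset Z_1=\tilde Z(H)\subset Z_2\subset\cdots$ is a series of normal left coideal subalgebras with $H_i=H//Z_i$. $H$ is nilpotent if $H_t=k$ (equivalently $Z_t=H$) for some $t$. Solvability: a chain of left coideal subalgebras $N_0\subset N_1\subset\dots\subset N_t$ of $H$ is a solvable series if for all $0\le i\le t-1$: (i) $\Lambda_{N_i}$ lies in the center of $N_{i+1}$; and (ii) $(a\,_{\dot{ad}}\,b)\Lambda_{N_i}=\langle\varepsilon,a\rangle b\Lambda_{N_i}$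 for all $a,b\in N_{i+1}$. $H$ is solvable if it has a solvable series with $N_0=k$ and $N_t=H$. *)

theory Defs
  imports "HOL-Computational_Algebra.Computational_Algebra"
begin

section \<open>Tensors\<close>

text \<open>
  A finite sum of pure tensors \<open>\<Sum>\<^sub>j a\<^sub>j \<otimes> b\<^sub>j\<close> is written as the list of the pairs \<open>(a\<^sub>j, b\<^sub>j)\<close>.
  The tensor square of a vector space (with scalar multiplication \<open>s\<close>) is the quotient of the
  monoid of these formal sums by the congruence that makes \<open>\<otimes>\<close> biadditive and balanced;
  two lists denote the same tensor iff they are related by \<open>tensor_eq s\<close>.
  For subspaces \<open>U\<close>, \<open>W\<close>, the space \<open>U \<otimes> W\<close> is regarded as a subspace of the ambient tensor
  square, which is legitimate over a field.
\<close>

inductive tensor_eq ::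
  "('k::field \<Rightarrow> 'a::ab_group_add \<Rightarrow> 'a) \<Rightarrow> ('a \<times> 'a) list \<Rightarrow> ('a \<times> 'a) list \<Rightarrow> bool"
  for s where
  refl: "tensor_eq s xs xs"
| sym: "tensor_eq s xs ys \<Longrightarrow> tensor_eq s ys xs"
| trans: "tensor_eq s xs ys \<Longrightarrow> tensor_eq s ys zs \<Longrightarrow> tensor_eq s xs zs"
| append: "tensor_eq s xs xs' \<Longrightarrow> tensor_eq s ys ys' \<Longrightarrow> tensor_eq s (xs @ ys) (xs' @ ys')"
| comm: "tensor_eq s (xs @ ys) (ys @ xs)"
| zero: "tensor_eq s [(0, b)] []"
| add_left: "tensor_eq s [(a + a', b)] [(a, b), (a', b)]"
| add_right: "tensor_eq s [(a, b + b')] [(a, b), (a, b')]"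
| balanced: "tensor_eq s [(s c a, b)] [(a, s c b)]"

text \<open>The same for the threefold tensor product.\<close>

inductive tensor3_eq ::
  "('k::field \<Rightarrow> 'a::ab_group_add \<Rightarrow> 'a) \<Rightarrow>
    ('a \<times> 'a \<times> 'a) list \<Rightarrow> ('a \<times> 'a \<times> 'a) list \<Rightarrow> bool"
  for s where
  refl: "tensor3_eq s xs xs"
| sym: "tensor3_eq s xs ys \<Longrightarrow> tensor3_eq s ys xs"
| trans: "tensor3_eq s xs ys \<Longrightarrow> tensor3_eq s ys zs \<Longrightarrow> tensor3_eq s xs zs"
| append: "tensor3_eq s xs xs' \<Longrightarrow> tensor3_eq s ys ys' \<Longrightarrow> tensor3_eq s (xs @ ys) (xs' @ ys')"
| comm: "tensor3_eq s (xs @ ys) (ys @ xs)"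
| zero: "tensor3_eq s [(0, b, d)] []"
| add1: "tensor3_eq s [(a + a', b, d)] [(a, b, d), (a', b, d)]"
| add2: "tensor3_eq s [(a, b + b', d)] [(a, b, d), (a, b', d)]"
| add3: "tensor3_eq s [(a, b, d + d')] [(a, b, d), (a, b, d')]"
| balanced12: "tensor3_eq s [(s c a, b, d)] [(a, s c b, d)]"
| balanced23: "tensor3_eq s [(a, s c b, d)] [(a, b, s c d)]"

definition tensor_in ::
  "('k::field \<Rightarrow> 'a::ab_group_add \<Rightarrow> 'a) \<Rightarrow> ('a \<times> 'a) list \<Rightarrow> 'a set \<Rightarrow> 'a set \<Rightarrow> bool" where
  "tensor_in s xs U W \<longleftrightarrow> (\<exists>ys. set ys \<subseteq> U \<times> W \<and> tensor_eq s xs ys)"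


section \<open>Hopf algebras\<close>

text \<open>
  The underlying vector space \<open>hcarrier H\<close> is a subspace of an ambient vector space \<open>'a\<close>;
  this allows quotients to live on the same type.  The list \<open>hcomult H h\<close> is a choice of
  Sweedler summands \<open>\<Sum> h\<^sub>1 \<otimes> h\<^sub>2\<close> representing the tensor \<open>\<Delta>(h)\<close>, so equations between values
  of the comultiplication are stated up to \<open>tensor_eq\<close>.
\<close>

record ('k, 'a) hopf =
  hcarrier :: "'a set"
  hscale :: "'k \<Rightarrow> 'a \<Rightarrow> 'a" (infixr "\<odot>\<index>" 75)
  hmult :: "'a \<Rightarrow> 'a \<Rightarrow> 'a" (infixl "\<cdot>\<index>" 70)
  hunit :: "'a" ("\<one>\<index>")
  hcomult :: "'a \<Rightarrow> ('a \<times> 'a) list" ("\<Delta>\<index>")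
  hcounit :: "'a \<Rightarrow> 'k" ("\<epsilon>\<index>")
  hantipode :: "'a \<Rightarrow> 'a"

locale unital_algebra = vector_space "hscale H"
  for H :: "('k::field, 'a::ab_group_add) hopf" (structure) +
  assumes carrier_subspace: "subspace (hcarrier H)"
    and mult_closed: "\<lbrakk>x \<in> hcarrier H; y \<in> hcarrier H\<rbrakk> \<Longrightarrow> x \<cdot> y \<in> hcarrier H"
    and unit_closed: "\<one> \<in> hcarrier H"
    and mult_assoc: "\<lbrakk>x \<in> hcarrier H; y \<in> hcarrier H; z \<in> hcarrier H\<rbrakk> \<Longrightarrow>
          (x \<cdot> y) \<cdot> z = x \<cdot> (y \<cdot> z)"
    and unit_left: "x \<in> hcarrier H \<Longrightarrow> \<one> \<cdot> x = x"
    and unit_right: "x \<in> hcarrier H \<Longrightarrow> x \<cdot> \<one> = x"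
    and mult_add_left: "\<lbrakk>x \<in> hcarrier H; y \<in> hcarrier H; z \<in> hcarrier H\<rbrakk> \<Longrightarrow>
          (x + y) \<cdot> z = x \<cdot> z + y \<cdot> z"
    and mult_add_right: "\<lbrakk>x \<in> hcarrier H; y \<in> hcarrier H; z \<in> hcarrier H\<rbrakk> \<Longrightarrow>
          x \<cdot> (y + z) = x \<cdot> y + x \<cdot> z"
    and mult_scale_left: "\<lbrakk>x \<in> hcarrier H; y \<in> hcarrier H\<rbrakk> \<Longrightarrow> (c \<odot> x) \<cdot> y = c \<odot> (x \<cdot> y)"
    and mult_scale_right: "\<lbrakk>x \<in> hcarrier H; y \<in> hcarrier H\<rbrakk> \<Longrightarrow> x \<cdot> (c \<odot> y) = c \<odot> (x \<cdot> y)"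

locale coalgebra = vector_space "hscale H"
  for H :: "('k::field, 'a::ab_group_add) hopf" (structure) +
  assumes coalgebra_carrier: "subspace (hcarrier H)"
    and comult_closed: "x \<in> hcarrier H \<Longrightarrow> set (\<Delta> x) \<subseteq> hcarrier H \<times> hcarrier H"
    and comult_add: "\<lbrakk>x \<in> hcarrier H; y \<in> hcarrier H\<rbrakk> \<Longrightarrow>
          tensor_eq (hscale H) (\<Delta> (x + y)) (\<Delta> x @ \<Delta> y)"
    and comult_scale: "x \<in> hcarrier H \<Longrightarrow>
          tensor_eq (hscale H) (\<Delta> (c \<odot> x)) [(c \<odot> a, b). (a, b) \<leftarrow> \<Delta> x]"
    and coassoc: "x \<in> hcarrier H \<Longrightarrow>
          tensor3_eq (hscale H) [(a, b, d). (u, d) \<leftarrow> \<Delta> x, (a, b) \<leftarrow> \<Delta> u]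
                                [(a, b, d). (a, v) \<leftarrow> \<Delta> x, (b, d) \<leftarrow> \<Delta> v]"
    and counit_add: "\<lbrakk>x \<in> hcarrier H; y \<in> hcarrier H\<rbrakk> \<Longrightarrow> \<epsilon> (x + y) = \<epsilon> x + \<epsilon> y"
    and counit_scale: "x \<in> hcarrier H \<Longrightarrow> \<epsilon> (c \<odot> x) = c * \<epsilon> x"
    and counit_left: "x \<in> hcarrier H \<Longrightarrow> (\<Sum>(a, b)\<leftarrow>\<Delta> x. \<epsilon> a \<odot> b) = x"
    and counit_right: "x \<in> hcarrier H \<Longrightarrow> (\<Sum>(a, b)\<leftarrow>\<Delta> x. \<epsilon> b \<odot> a) = x"

locale bialgebra = unital_algebra H + coalgebra H
  for H :: "('k::field, 'a::ab_group_add) hopf" (structure) +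
  assumes comult_mult: "\<lbrakk>x \<in> hcarrier H; y \<in> hcarrier H\<rbrakk> \<Longrightarrow>
          tensor_eq (hscale H) (\<Delta> (x \<cdot> y)) [(a \<cdot> c, b \<cdot> d). (a, b) \<leftarrow> \<Delta> x, (c, d) \<leftarrow> \<Delta> y]"
    and comult_unit: "tensor_eq (hscale H) (\<Delta> \<one>) [(\<one>, \<one>)]"
    and counit_mult: "\<lbrakk>x \<in> hcarrier H; y \<in> hcarrier H\<rbrakk> \<Longrightarrow> \<epsilon> (x \<cdot> y) = \<epsilon> x * \<epsilon> y"
    and counit_unit: "\<epsilon> \<one> = 1"

locale hopf_algebra = bialgebra H
  for H :: "('k::field, 'a::ab_group_add) hopf" (structure) +
  assumes antipode_closed: "x \<in> hcarrier H \<Longrightarrow> hantipode H x \<in> hcarrier H"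
    and antipode_add: "\<lbrakk>x \<in> hcarrier H; y \<in> hcarrier H\<rbrakk> \<Longrightarrow>
          hantipode H (x + y) = hantipode H x + hantipode H y"
    and antipode_scale: "x \<in> hcarrier H \<Longrightarrow> hantipode H (c \<odot> x) = c \<odot> hantipode H x"
    and antipode_left: "x \<in> hcarrier H \<Longrightarrow> (\<Sum>(a, b)\<leftarrow>\<Delta> x. hantipode H a \<cdot> b) = \<epsilon> x \<odot> \<one>"
    and antipode_right: "x \<in> hcarrier H \<Longrightarrow> (\<Sum>(a, b)\<leftarrow>\<Delta> x. a \<cdot> hantipode H b) = \<epsilon> x \<odot> \<one>"

definition left_ideal :: "('k::field, 'a::ab_group_add) hopf \<Rightarrow> 'a set \<Rightarrow> bool" where
  "left_ideal H I \<longleftrightarrow> I \<subseteq> hcarrier H \<and> module.subspace (hscale H) I \<and>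
     (\<forall>h\<in>hcarrier H. \<forall>x\<in>I. h \<cdot>\<^bsub>H\<^esub> x \<in> I)"

text \<open>
  Semisimplicity of the underlying algebra: the left regular module is completely reducible.
\<close>

definition hopf_semisimple :: "('k::field, 'a::ab_group_add) hopf \<Rightarrow> bool" where
  "hopf_semisimple H \<longleftrightarrow> (\<forall>I. left_ideal H I \<longrightarrow>
     (\<exists>J. left_ideal H J \<and> I \<inter> J = {0} \<and> {x + y | x y. x \<in> I \<and> y \<in> J} = hcarrier H))"

definition scalars :: "('k::field, 'a::ab_group_add) hopf \<Rightarrow> 'a set" where
  "scalars H = range (\<lambda>c. c \<odot>\<^bsub>H\<^esub> \<one>\<^bsub>H\<^esub>)"

definition unital_subalgebra :: "('k::field, 'a::ab_group_add) hopf \<Rightarrow> 'a set \<Rightarrow> bool" where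
  "unital_subalgebra H N \<longleftrightarrow> N \<subseteq> hcarrier H \<and> module.subspace (hscale H) N \<and> \<one>\<^bsub>H\<^esub> \<in> N \<and>
     (\<forall>x\<in>N. \<forall>y\<in>N. x \<cdot>\<^bsub>H\<^esub> y \<in> N)"

definition left_coideal_subalgebra :: "('k::field, 'a::ab_group_add) hopf \<Rightarrow> 'a set \<Rightarrow> bool" where
  "left_coideal_subalgebra H N \<longleftrightarrow> unital_subalgebra H N \<and>
     (\<forall>n\<in>N. tensor_in (hscale H) (\<Delta>\<^bsub>H\<^esub> n) (hcarrier H) N)"

definition hopf_subalgebra :: "('k::field, 'a::ab_group_add) hopf \<Rightarrow> 'a set \<Rightarrow> bool" where
  "hopf_subalgebra H K \<longleftrightarrow> unital_subalgebra H K \<and>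
     (\<forall>x\<in>K. tensor_in (hscale H) (\<Delta>\<^bsub>H\<^esub> x) K K) \<and> (\<forall>x\<in>K. hantipode H x \<in> K)"

text \<open>The center of the subalgebra \<open>N\<close> (not its centralizer in \<open>H\<close>).\<close>

definition center_of :: "('k::field, 'a::ab_group_add) hopf \<Rightarrow> 'a set \<Rightarrow> 'a set" where
  "center_of H N = {z \<in> N. \<forall>x\<in>N. z \<cdot>\<^bsub>H\<^esub> x = x \<cdot>\<^bsub>H\<^esub> z}"

definition hopf_center :: "('k::field, 'a::ab_group_add) hopf \<Rightarrow> 'a set" where
  "hopf_center H = (GREATEST K. hopf_subalgebra H K \<and> K \<subseteq> center_of H (hcarrier H))"

definition left_adjoint :: "('k::field, 'a::ab_group_add) hopf \<Rightarrow> 'a \<Rightarrow> 'a \<Rightarrow> 'a" where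
  "left_adjoint H a b = (\<Sum>(a1, a2)\<leftarrow>\<Delta>\<^bsub>H\<^esub> a. a1 \<cdot>\<^bsub>H\<^esub> b \<cdot>\<^bsub>H\<^esub> hantipode H a2)"


section \<open>Quotients and nilpotency\<close>

definition augmentation :: "('k::field, 'a::ab_group_add) hopf \<Rightarrow> 'a set \<Rightarrow> 'a set" where
  "augmentation H N = {n \<in> N. \<epsilon>\<^bsub>H\<^esub> n = 0}"

definition augmentation_ideal :: "('k::field, 'a::ab_group_add) hopf \<Rightarrow> 'a set \<Rightarrow> 'a set" where
  "augmentation_ideal H N =
     module.span (hscale H) {h \<cdot>\<^bsub>H\<^esub> n | h n. h \<in> hcarrier H \<and> n \<in> augmentation H N}"

text \<open>
  The quotient \<open>H // N = H / HN\<^sup>+\<close> is realised on a linear complement of \<open>HN\<^sup>+\<close> in \<open>H\<close>, used as a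
  system of coset representatives: \<open>quotient_proj H N\<close> is a linear idempotent of \<open>H\<close> with
  kernel \<open>HN\<^sup>+\<close>, it plays the role of the canonical map \<open>H \<rightarrow> H // N\<close>, and all operations are
  induced along it.  The counit vanishes on \<open>HN\<^sup>+\<close> and is simply evaluated on representatives.
\<close>

definition quotient_proj :: "('k::field, 'a::ab_group_add) hopf \<Rightarrow> 'a set \<Rightarrow> 'a \<Rightarrow> 'a" where
  "quotient_proj H N = (SOME p. Vector_Spaces.linear (hscale H) (hscale H) p \<and>
     p ` hcarrier H \<subseteq> hcarrier H \<and> (\<forall>x\<in>hcarrier H. p (p x) = p x) \<and>
     {x \<in> hcarrier H. p x = 0} = augmentation_ideal H N)"

definition hopf_quotient ::
  "('k::field, 'a::ab_group_add) hopf \<Rightarrow> 'a set \<Rightarrow> ('k, 'a) hopf" where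
  "hopf_quotient H N = (let p = quotient_proj H N in
     \<lparr> hcarrier = p ` hcarrier H,
       hscale = hscale H,
       hmult = (\<lambda>x y. p (x \<cdot>\<^bsub>H\<^esub> y)),
       hunit = p \<one>\<^bsub>H\<^esub>,
       hcomult = (\<lambda>x. [(p a, p b). (a, b) \<leftarrow> \<Delta>\<^bsub>H\<^esub> x]),
       hcounit = \<epsilon>\<^bsub>H\<^esub>,
       hantipode = (\<lambda>x. p (hantipode H x)) \<rparr>)"

primrec central_quotient :: "('k::field, 'a::ab_group_add) hopf \<Rightarrow> nat \<Rightarrow> ('k, 'a) hopf" where
  "central_quotient H 0 = H"
| "central_quotient H (Suc i) =
     hopf_quotient (central_quotient H i) (hopf_center (central_quotient H i))"

definition hopf_nilpotent :: "('k::field, 'a::ab_group_add) hopf \<Rightarrow> bool" where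
  "hopf_nilpotent H \<longleftrightarrow>
     (\<exists>t. hcarrier (central_quotient H t) = scalars (central_quotient H t))"


section \<open>Integrals and solvability\<close>

text \<open>Two-sided integrals of \<open>N\<close> normalised by the counit; they are automatically idempotent and unique.\<close>

definition is_integral :: "('k::field, 'a::ab_group_add) hopf \<Rightarrow> 'a set \<Rightarrow> 'a \<Rightarrow> bool" where
  "is_integral H N L \<longleftrightarrow> L \<in> N \<and> \<epsilon>\<^bsub>H\<^esub> L = 1 \<and>
     (\<forall>n\<in>N. n \<cdot>\<^bsub>H\<^esub> L = \<epsilon>\<^bsub>H\<^esub> n \<odot>\<^bsub>H\<^esub> L \<and> L \<cdot>\<^bsub>H\<^esub> n = \<epsilon>\<^bsub>H\<^esub> n \<odot>\<^bsub>H\<^esub> L)"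

definition hopf_integral :: "('k::field, 'a::ab_group_add) hopf \<Rightarrow> 'a set \<Rightarrow> 'a" where
  "hopf_integral H N = (THE L. is_integral H N L)"

definition solvable_series ::
  "('k::field, 'a::ab_group_add) hopf \<Rightarrow> (nat \<Rightarrow> 'a set) \<Rightarrow> nat \<Rightarrow> bool" where
  "solvable_series H N t \<longleftrightarrow>
     (\<forall>i\<le>t. left_coideal_subalgebra H (N i)) \<and>
     (\<forall>i<t. N i \<subseteq> N (Suc i) \<and>
        hopf_integral H (N i) \<in> center_of H (N (Suc i)) \<and>
        (\<forall>a\<in>N (Suc i). \<forall>b\<in>N (Suc i).
           left_adjoint H a b \<cdot>\<^bsub>H\<^esub> hopf_integral H (N i) =
             \<epsilon>\<^bsub>H\<^esub> a \<odot>\<^bsub>H\<^esub> (b \<cdot>\<^bsub>H\<^esub> hopf_integral H (N i))))"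

definition hopf_solvable :: "('k::field, 'a::ab_group_add) hopf \<Rightarrow> bool" where
  "hopf_solvable H \<longleftrightarrow> (\<exists>N t. solvable_series H N t \<and> N 0 = scalars H \<and> N t = hcarrier H)"

end

theory Submission
  imports Defs
begin

text \<open>
  All quotients in the series \<open>H = H\<^sub>0, H\<^sub>1, H\<^sub>2, \<dots>\<close> are direct factors of the algebra \<open>H\<close>.
  If \<open>K\<close> is a central Hopf subalgebra of a semisimple Hopf algebra, then \<open>K\<close> has an integral \<open>s\<close>
  with \<open>\<epsilon>(s) = 1\<close> (lemma \<open>central_subalgebra_integral\<close>); it is a central idempotent, the ideal
  \<open>HK\<^sup>+\<close> is the annihilator \<open>H(1 - s)\<close> of \<open>s\<close>, and so \<open>H // K\<close> is a copy of \<open>Hs\<close>.  By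
  iteration, \<open>H\<^sub>i\<close> is a copy of \<open>He\<^sub>i\<close> for central idempotents \<open>e\<^sub>0 = 1, e\<^sub>1, e\<^sub>2, \<dots>\<close>, where
  \<open>e\<^sub>i\<^sub>+\<^sub>1 \<in> He\<^sub>i\<close> lifts the integral of the Hopf center of \<open>H\<^sub>i\<close>.  A solvable series is given by

  \<open>N\<^sub>i = {h. h\<^sub>1 \<otimes> h\<^sub>2 e\<^sub>i = h \<otimes> e\<^sub>i}\<close>,

  the coinvariants of the projection \<open>\<pi>\<^sub>i : H \<rightarrow> H\<^sub>i\<close>.  Such a set is a left coideal subalgebra for every
  element in place of \<open>e\<^sub>i\<close>, and every \<open>n \<in> N\<^sub>i\<close> satisfies \<open>n e\<^sub>i = \<epsilon>(n) e\<^sub>i\<close>.  The equation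
  \<open>\<Delta>(e\<^sub>i)(1 \<otimes> e\<^sub>i) = e\<^sub>i \<otimes> e\<^sub>i\<close>, which says that \<open>e\<^sub>i \<in> N\<^sub>i\<close>, is preserved by the induction step
  (lemma \<open>central_quotient_step\<close>).  Hence \<open>e\<^sub>i\<close> is the integral of \<open>N\<^sub>i\<close>, and it is central even in \<open>H\<close>.

  For the condition on the adjoint action let \<open>b \<in> N\<^sub>i\<^sub>+\<^sub>1\<close>.  Then \<open>\<pi>\<^sub>i(b)\<close> is coinvariant for the
  projection of \<open>H\<^sub>i\<close> onto \<open>H\<^sub>i\<^sub>+\<^sub>1\<close>.  The coinvariants of the quotient by a Hopf subalgebra with
  integral are that Hopf subalgebra (lemma \<open>coinvariants_in_support\<close>), so \<open>\<pi>\<^sub>i(b)\<close> lies in the Hopf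
  center of \<open>H\<^sub>i\<close>.  Thus \<open>b e\<^sub>i\<close> is central in \<open>H\<close>, and for all \<open>a \<in> H\<close>

  \<open>a\<^sub>1 b S(a\<^sub>2) e\<^sub>i = a\<^sub>1 S(a\<^sub>2) b e\<^sub>i = \<epsilon>(a) b e\<^sub>i\<close>.

  Computations with Sweedler summands are computations with sums of multilinear maps over the chosen
  lists.  Two formal sums of tensors are equal as tensors if every linear functional, applied to the
  left factors, gives the same vector (lemma \<open>tensor_eqI_functionals\<close>); this turns an equation between
  tensors into a family of equations between such sums.
\<close>

section \<open>Sums over formal tensors\<close>

definition tensor_sum :: "('a \<times> 'b) list \<Rightarrow> ('a \<Rightarrow> 'b \<Rightarrow> 'c::comm_monoid_add) \<Rightarrow> 'c" where
  "tensor_sum xs B = (\<Sum>(a, b)\<leftarrow>xs. B a b)"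

lemma tensor_sum_Nil [simp]: "tensor_sum [] B = 0"
  and tensor_sum_Cons [simp]: "tensor_sum (p # xs) B = B (fst p) (snd p) + tensor_sum xs B"
  and tensor_sum_append [simp]: "tensor_sum (xs @ ys) B = tensor_sum xs B + tensor_sum ys B"
  by (simp_all add: tensor_sum_def case_prod_unfold)

lemma tensor_sum_cong:
  assumes "\<And>a b. (a, b) \<in> set xs \<Longrightarrow> B a b = B' a b"
  shows "tensor_sum xs B = tensor_sum xs B'"
  using assms by (induction xs) (auto simp: tensor_sum_def)

lemma tensor_sum_map:
  "tensor_sum (map (\<lambda>(a, b). (f a b, g a b)) xs) B = tensor_sum xs (\<lambda>a b. B (f a b) (g a b))"
  by (induction xs) (auto simp: tensor_sum_def)

lemma tensor_sum_product:
  "tensor_sum [(f a b c d, g a b c d). (a, b) \<leftarrow> xs, (c, d) \<leftarrow> ys] B =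
     tensor_sum xs (\<lambda>a b. tensor_sum ys (\<lambda>c d. B (f a b c d) (g a b c d)))"
proof (induction xs)
  case (Cons p xs)
  have "tensor_sum (map (\<lambda>(c, d). (f (fst p) (snd p) c d, g (fst p) (snd p) c d)) ys) B =
      tensor_sum ys (\<lambda>c d. B (f (fst p) (snd p) c d) (g (fst p) (snd p) c d))"
    by (rule tensor_sum_map)
  with Cons show ?case by (simp add: case_prod_unfold)
qed simp

lemma tensor_sum_add:
  "tensor_sum xs (\<lambda>a b. B a b + B' a b) = tensor_sum xs B + tensor_sum xs B'"
  by (induction xs) (simp_all add: ac_simps)

lemma tensor_sum_zero [simp]: "tensor_sum xs (\<lambda>a b. 0) = 0"
  by (induction xs) simp_all

lemma tensor_sum_swap:
  "tensor_sum xs (\<lambda>a b. tensor_sum ys (\<lambda>c d. B a b c d)) =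
     tensor_sum ys (\<lambda>c d. tensor_sum xs (\<lambda>a b. B a b c d))"
  by (induction xs) (simp_all add: tensor_sum_add)

text \<open>
  The two iterated coproducts are compared by evaluating a trilinear map on both; the lemmas
  \<open>triple_sum_left\<close> and \<open>triple_sum_right\<close> unfold these evaluations into nested sums.
\<close>

definition triple_sum ::
  "('a \<times> 'b \<times> 'd) list \<Rightarrow> ('a \<Rightarrow> 'b \<Rightarrow> 'd \<Rightarrow> 'c::comm_monoid_add) \<Rightarrow> 'c" where
  "triple_sum xs T = (\<Sum>(a, b, d)\<leftarrow>xs. T a b d)"

lemma triple_sum_append [simp]: "triple_sum (xs @ ys) T = triple_sum xs T + triple_sum ys T"
  by (simp add: triple_sum_def)

lemma triple_sum_left:
  "triple_sum [(a, b, d). (u, d) \<leftarrow> xs, (a, b) \<leftarrow> D u] T =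
     tensor_sum xs (\<lambda>u d. tensor_sum (D u) (\<lambda>a b. T a b d))"
proof (induction xs)
  case (Cons p xs)
  have "triple_sum [(a, b, d). (a, b) \<leftarrow> ys] T = tensor_sum ys (\<lambda>a b. T a b d)" for ys and d
    by (induction ys) (auto simp: triple_sum_def)
  with Cons show ?case by (simp add: case_prod_unfold)
qed (simp add: triple_sum_def)

lemma triple_sum_right:
  "triple_sum [(a, b, d). (a, v) \<leftarrow> xs, (b, d) \<leftarrow> D v] T =
     tensor_sum xs (\<lambda>a v. tensor_sum (D v) (\<lambda>b d. T a b d))"
proof (induction xs)
  case (Cons p xs)
  have "triple_sum [(a, b, d). (b, d) \<leftarrow> ys] T = tensor_sum ys (\<lambda>b d. T a b d)" for ys and a
    by (induction ys) (auto simp: triple_sum_def)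
  with Cons show ?case by (simp add: case_prod_unfold)
qed (simp add: triple_sum_def)

text \<open>
  A separate locale keeps the names below from being duplicated by the interpretation of
  \<open>vector_space\<close> for real vector spaces.
\<close>

locale tensor_space = vector_space scale
  for scale :: "'k::field \<Rightarrow> 'a::ab_group_add \<Rightarrow> 'a"
begin

interpretation dual: vector_space_pair scale "(*)"
  by unfold_locales (auto simp: algebra_simps)

interpretation endo: vector_space_pair scale scale
  by unfold_locales

abbreviation functional :: "('a \<Rightarrow> 'k) \<Rightarrow> bool" where
  "functional \<equiv> Vector_Spaces.linear scale (*)"

lemma functional_add: "functional f \<Longrightarrow> f (x + y) = f x + f y" for f :: "'a \<Rightarrow> 'k"
  by (rule dual.linear_add)

lemma functional_scale: "functional f \<Longrightarrow> f (scale c x) = c * f x" for f :: "'a \<Rightarrow> 'k"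
  by (rule dual.linear_scale)

lemma functional_zero: "functional f \<Longrightarrow> f 0 = 0" for f :: "'a \<Rightarrow> 'k"
  by (rule dual.linear_0)

lemma functional_minus: "functional f \<Longrightarrow> f (- x) = - f x" for f :: "'a \<Rightarrow> 'k"
  by (rule dual.linear_neg)

lemma functionalI:
  assumes "\<And>x y. f (x + y) = f x + f y" "\<And>c x. f (scale c x) = c * f x"
  shows "functional f"
  unfolding Vector_Spaces.linear_iff
  using assms vector_space_axioms dual.vs2.vector_space_axioms by blast

lemma scale_tensor_sum: "scale c (tensor_sum xs B) = tensor_sum xs (\<lambda>a b. scale c (B a b))"
  by (induction xs) (simp_all add: scale_right_distrib)

lemma tensor_sum_in:
  assumes "subspace V" "\<And>a b. (a, b) \<in> set xs \<Longrightarrow> B a b \<in> V"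
  shows "tensor_sum xs B \<in> V"
  using assms(2)
  by (induction xs) (auto intro!: subspace_add assms(1) simp: subspace_0[OF assms(1)])

text \<open>
  The operations of a Hopf algebra are controlled on its carrier only, so linearity is relative to a
  subspace.
\<close>

definition linear_on :: "'a set \<Rightarrow> ('a \<Rightarrow> 'a) \<Rightarrow> bool" where
  "linear_on V g \<longleftrightarrow> (\<forall>x\<in>V. \<forall>y\<in>V. g (x + y) = g x + g y) \<and>
     (\<forall>c. \<forall>x\<in>V. g (scale c x) = scale c (g x))"

definition bilinear_on :: "'a set \<Rightarrow> ('a \<Rightarrow> 'a \<Rightarrow> 'a) \<Rightarrow> bool" where
  "bilinear_on V B \<longleftrightarrow> (\<forall>y\<in>V. linear_on V (\<lambda>x. B x y)) \<and> (\<forall>x\<in>V. linear_on V (\<lambda>y. B x y))"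

definition trilinear_on :: "'a set \<Rightarrow> ('a \<Rightarrow> 'a \<Rightarrow> 'a \<Rightarrow> 'a) \<Rightarrow> bool" where
  "trilinear_on V T \<longleftrightarrow> (\<forall>y\<in>V. \<forall>z\<in>V. linear_on V (\<lambda>x. T x y z)) \<and>
     (\<forall>x\<in>V. \<forall>z\<in>V. linear_on V (\<lambda>y. T x y z)) \<and> (\<forall>x\<in>V. \<forall>y\<in>V. linear_on V (\<lambda>z. T x y z))"

lemma linear_onI:
  assumes "\<And>x y. x \<in> V \<Longrightarrow> y \<in> V \<Longrightarrow> g (x + y) = g x + g y"
    and "\<And>c x. x \<in> V \<Longrightarrow> g (scale c x) = scale c (g x)"
  shows "linear_on V g"
  using assms by (auto simp: linear_on_def)

lemma linear_on_add: "linear_on V g \<Longrightarrow> x \<in> V \<Longrightarrow> y \<in> V \<Longrightarrow> g (x + y) = g x + g y"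
  and linear_on_scale: "linear_on V g \<Longrightarrow> x \<in> V \<Longrightarrow> g (scale c x) = scale c (g x)"
  by (auto simp: linear_on_def)

lemma linear_on_zero: "subspace V \<Longrightarrow> linear_on V g \<Longrightarrow> g 0 = 0"
  using linear_on_scale[of V g 0 0] by (simp add: subspace_0)

lemma linear_on_tensor_sum_apply:
  assumes "subspace V" "linear_on V g" "\<And>a b. (a, b) \<in> set xs \<Longrightarrow> B a b \<in> V"
  shows "g (tensor_sum xs B) = tensor_sum xs (\<lambda>a b. g (B a b))"
  using assms(3)
proof (induction xs)
  case Nil
  then show ?case using assms linear_on_zero by simp
next
  case (Cons p xs)
  have "tensor_sum xs B \<in> V" using Cons assms(1) by (intro tensor_sum_in) auto
  with Cons assms(2) show ?case by (cases p) (auto simp: linear_on_add)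
qed

lemma bilinear_onI:
  assumes "\<And>y. y \<in> V \<Longrightarrow> linear_on V (\<lambda>x. B x y)" "\<And>x. x \<in> V \<Longrightarrow> linear_on V (\<lambda>y. B x y)"
  shows "bilinear_on V B"
  using assms by (auto simp: bilinear_on_def)

lemma trilinear_onI:
  assumes "\<And>y z. y \<in> V \<Longrightarrow> z \<in> V \<Longrightarrow> linear_on V (\<lambda>x. T x y z)"
    and "\<And>x z. x \<in> V \<Longrightarrow> z \<in> V \<Longrightarrow> linear_on V (\<lambda>y. T x y z)"
    and "\<And>x y. x \<in> V \<Longrightarrow> y \<in> V \<Longrightarrow> linear_on V (\<lambda>z. T x y z)"
  shows "trilinear_on V T"
  using assms by (auto simp: trilinear_on_def)

lemma linear_on_ident: "linear_on V (\<lambda>x. x)"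
  by (simp add: linear_on_def)

lemma linear_on_comp:
  "Vector_Spaces.linear scale scale p \<Longrightarrow> linear_on V g \<Longrightarrow> linear_on V (\<lambda>x. p (g x))"
  by (simp add: linear_on_def endo.linear_add endo.linear_scale)

lemma linear_on_functional:
  "functional f \<Longrightarrow> linear_on V g \<Longrightarrow> linear_on V (\<lambda>x. scale (f (g x)) v)"
  by (simp add: linear_on_def functional_add functional_scale scale_left_distrib)

lemma linear_on_scale_const: "linear_on V g \<Longrightarrow> linear_on V (\<lambda>x. scale c (g x))"
  by (simp add: linear_on_def scale_right_distrib scale_left_commute)

lemma linear_on_sum:
  assumes "\<And>a b. (a, b) \<in> set xs \<Longrightarrow> linear_on V (\<lambda>x. B x a b)"
  shows "linear_on V (\<lambda>x. tensor_sum xs (B x))"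
  using assms
proof (induction xs)
  case (Cons p xs)
  have "linear_on V (\<lambda>x. B x (fst p) (snd p))" using Cons(2)[of "fst p" "snd p"] by simp
  with Cons show ?case
    by (simp add: linear_on_def algebra_simps)
qed (simp add: linear_on_def)

lemma linear_projection_exists:
  assumes "subspace V"
  obtains P where "Vector_Spaces.linear scale scale P" "\<And>x. x \<in> V \<Longrightarrow> P x = x" "\<And>x. P x \<in> V"
proof -
  obtain B where B: "B \<subseteq> V" "independent B" "V \<subseteq> span B"
    using maximal_independent_subset by blast
  obtain g where g: "Vector_Spaces.linear scale scale g" "\<forall>x\<in>B. g x = id x"
      "range g = span (id ` B)"
    using endo.linear_independent_extend_subspace[OF B(2)] by blast
  have "g x = x" if "x \<in> V" for x
    using that B(3) g(2) endo.linear_eq_on_span[OF g(1) linear_id, of B x] by auto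
  moreover have "g x \<in> V" for x
  proof -
    have "g x \<in> span B" using g(3) by auto
    then show ?thesis using span_minimal[OF B(1) assms] by auto
  qed
  ultimately show ?thesis using g(1) that by blast
qed

lemma functional_comp:
  assumes "functional f" "Vector_Spaces.linear scale scale P" "\<And>x. P x \<in> V" "linear_on V g"
  shows "functional (\<lambda>x. f (g (P x)))"
proof -
  have "g (P (x + y)) = g (P x) + g (P y)" "g (P (scale c x)) = scale c (g (P x))" for c x y
    using assms(3,4) by (simp_all add: endo.linear_add[OF assms(2)] endo.linear_scale[OF assms(2)] linear_on_def)
  then show ?thesis
    unfolding Vector_Spaces.linear_iff
    by (simp add: functional_add[OF assms(1)] functional_scale[OF assms(1)]
        vector_space_axioms dual.vs2.vector_space_axioms)
qed

lemma tensor_eq_sum_global: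
  assumes "tensor_eq scale xs ys"
    and "bilinear_on UNIV B"
  shows "tensor_sum xs B = tensor_sum ys B"
  using assms(1)
proof (induction rule: tensor_eq.induct)
  case (zero b)
  then show ?case using assms(2) linear_on_zero[OF subspace_UNIV, of "\<lambda>x. B x b"]
    by (auto simp: bilinear_on_def)
qed (use assms(2) in \<open>auto simp: bilinear_on_def linear_on_def add.commute\<close>)

text \<open>
  A chain of relations between the two lists may leave \<open>V\<close>, where nothing is known about \<open>B\<close>.
  Composing \<open>B\<close> with a linear projection onto \<open>V\<close> gives a map that is bilinear everywhere and agrees
  with \<open>B\<close> on both lists.
\<close>

lemma tensor_eq_sum:
  assumes "tensor_eq scale xs ys" "subspace V" "bilinear_on V B"
    and "set xs \<subseteq> V \<times> V" "set ys \<subseteq> V \<times> V"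
  shows "tensor_sum xs B = tensor_sum ys B"
proof -
  obtain P where P: "Vector_Spaces.linear scale scale P" "\<And>x. x \<in> V \<Longrightarrow> P x = x" "\<And>x. P x \<in> V"
    using linear_projection_exists[OF assms(2)] by metis
  have "bilinear_on UNIV (\<lambda>a b. B (P a) (P b))"
    using assms(3) P by (auto simp: bilinear_on_def linear_on_def endo.linear_add endo.linear_scale)
  then have "tensor_sum xs (\<lambda>a b. B (P a) (P b)) = tensor_sum ys (\<lambda>a b. B (P a) (P b))"
    by (rule tensor_eq_sum_global[OF assms(1)])
  moreover have "tensor_sum zs (\<lambda>a b. B (P a) (P b)) = tensor_sum zs B" if "set zs \<subseteq> V \<times> V" for zs
    using that P(2) by (intro tensor_sum_cong) auto
  ultimately show ?thesis using assms(4,5) by simp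
qed

lemma tensor3_eq_sum_global:
  assumes "tensor3_eq scale xs ys" "trilinear_on UNIV T"
  shows "triple_sum xs T = triple_sum ys T"
  using assms(1)
proof (induction rule: tensor3_eq.induct)
  case (zero b d)
  then show ?case using assms(2) linear_on_zero[OF subspace_UNIV, of "\<lambda>x. T x b d"]
    by (auto simp: trilinear_on_def triple_sum_def)
next
  case (append xs xs' ys ys')
  then show ?case by simp
next
  case (comm xs ys)
  then show ?case by (simp add: add.commute)
qed (use assms(2) in \<open>auto simp: trilinear_on_def linear_on_def triple_sum_def\<close>)

lemma tensor3_eq_sum:
  assumes "tensor3_eq scale xs ys" "subspace V" "trilinear_on V T"
    and "set xs \<subseteq> V \<times> V \<times> V" "set ys \<subseteq> V \<times> V \<times> V"
  shows "triple_sum xs T = triple_sum ys T"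
proof -
  obtain P where P: "Vector_Spaces.linear scale scale P" "\<And>x. x \<in> V \<Longrightarrow> P x = x" "\<And>x. P x \<in> V"
    using linear_projection_exists[OF assms(2)] by metis
  have "trilinear_on UNIV (\<lambda>a b d. T (P a) (P b) (P d))"
    using assms(3) P by (auto simp: trilinear_on_def linear_on_def endo.linear_add endo.linear_scale)
  then have "triple_sum xs (\<lambda>a b d. T (P a) (P b) (P d)) = triple_sum ys (\<lambda>a b d. T (P a) (P b) (P d))"
    by (rule tensor3_eq_sum_global[OF assms(1)])
  moreover have "triple_sum zs (\<lambda>a b d. T (P a) (P b) (P d)) = triple_sum zs T"
    if "set zs \<subseteq> V \<times> V \<times> V" for zs
    unfolding triple_sum_def using that P(2)
    by (intro arg_cong[of _ _ sum_list] map_cong) auto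
  ultimately show ?thesis using assms(4,5) by simp
qed

lemma tensor_eq_zero_right: "tensor_eq scale [(a, 0)] []"
proof -
  have "tensor_eq scale [(scale 0 a, 0)] [(a, scale 0 0)]" by (rule tensor_eq.balanced)
  then have "tensor_eq scale [(0, 0)] [(a, 0)]" by simp
  then show ?thesis using tensor_eq.trans tensor_eq.sym tensor_eq.zero by blast
qed

lemma tensor_eq_Cons: "tensor_eq scale xs ys \<Longrightarrow> tensor_eq scale (p # xs) (p # ys)"
  using tensor_eq.append[OF tensor_eq.refl[of scale "[p]"]] by fastforce

lemma tensor_eq_cancel:
  "tensor_eq scale (map (\<lambda>(a, b). (- a, b)) ys @ ys) []"
proof (induction ys)
  case (Cons p ys)
  obtain a b where p: "p = (a, b)" by fastforce
  let ?N = "map (\<lambda>(a, b). (- a, b)) ys"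
  have "tensor_eq scale (?N @ [(a, b)]) ([(a, b)] @ ?N)" by (rule tensor_eq.comm)
  then have "tensor_eq scale ((?N @ [(a, b)]) @ ys) (([(a, b)] @ ?N) @ ys)"
    by (rule tensor_eq.append[OF _ tensor_eq.refl])
  then have 1: "tensor_eq scale ((-a, b) # ?N @ [(a, b)] @ ys) ((-a, b) # (a, b) # ?N @ ys)"
    using tensor_eq_Cons by fastforce
  have "tensor_eq scale [(-a, b), (a, b)] [(-a + a, b)]"
    by (intro tensor_eq.sym[OF tensor_eq.add_left])
  then have "tensor_eq scale [(-a, b), (a, b)] []"
    using tensor_eq.zero tensor_eq.trans by fastforce
  then have "tensor_eq scale ([(-a, b), (a, b)] @ (?N @ ys)) ([] @ [])"
    using Cons.IH by (intro tensor_eq.append)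
  with 1 show ?case using p tensor_eq.trans by fastforce
qed (simp add: tensor_eq.refl)

text \<open>
  A summand whose left factor is a combination of the other left factors can be distributed over them.
\<close>

lemma tensor_eq_absorb:
  "tensor_eq scale ((tensor_sum ys (\<lambda>a' b'. scale (c a') a'), b) # ys)
     (map (\<lambda>(a', b'). (a', b' + scale (c a') b)) ys)"
proof (induction ys)
  case Nil
  show ?case by (simp add: tensor_eq.zero)
next
  case (Cons p ys)
  obtain a' b' where p: "p = (a', b')" by fastforce
  let ?t = "tensor_sum ys (\<lambda>a' b'. scale (c a') a')"
  have "tensor_eq scale [(scale (c a') a' + ?t, b)] ([(scale (c a') a', b)] @ [(?t, b)])"
    using tensor_eq.add_left by fastforce
  also have "tensor_eq scale \<dots> ([(a', scale (c a') b)] @ [(?t, b)])"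
    by (intro tensor_eq.append tensor_eq.balanced tensor_eq.refl)
  finally (tensor_eq.trans) have 1: "tensor_eq scale ([(scale (c a') a' + ?t, b)] @ ((a', b') # ys))
      (([(a', scale (c a') b)] @ [(?t, b)]) @ ((a', b') # ys))"
    by (intro tensor_eq.append tensor_eq.refl)
  have "tensor_eq scale ([(?t, b)] @ [(a', b')]) ([(a', b')] @ [(?t, b)])"
    by (rule tensor_eq.comm)
  then have "tensor_eq scale (([(a', scale (c a') b)] @ ([(?t, b)] @ [(a', b')])) @ ys)
      (([(a', scale (c a') b)] @ ([(a', b')] @ [(?t, b)])) @ ys)"
    by (intro tensor_eq.append[OF _ tensor_eq.refl] tensor_eq.append[OF tensor_eq.refl])
  then have 2: "tensor_eq scale (([(a', scale (c a') b)] @ [(?t, b)]) @ ((a', b') # ys))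
      ([(a', scale (c a') b), (a', b')] @ ((?t, b) # ys))"
    by simp
  have "tensor_eq scale [(a', scale (c a') b), (a', b')] [(a', scale (c a') b + b')]"
    by (rule tensor_eq.sym[OF tensor_eq.add_right])
  then have 3: "tensor_eq scale ([(a', scale (c a') b), (a', b')] @ ((?t, b) # ys))
      ([(a', scale (c a') b + b')] @ map (\<lambda>(a', b'). (a', b' + scale (c a') b)) ys)"
    using Cons.IH by (intro tensor_eq.append)
  show ?case using tensor_eq.trans[OF 1 tensor_eq.trans[OF 2 3]] p by (simp add: add.commute)
qed

lemma tensor_sum_fst:
  "distinct (map fst ys) \<Longrightarrow> tensor_sum ys (\<lambda>a b. g a) = sum g (fst ` set ys)"
  by (induction ys) (auto simp: image_iff)

text \<open>
  With independent left factors, the right factors can be read off by dual functionals.  Such a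
  representation is found by induction on the list: a new left factor in the span of the previous
  ones is absorbed.
\<close>

lemma tensor_independent_representation:
  assumes "subspace W" "set xs \<subseteq> V \<times> W"
  shows "\<exists>ys. tensor_eq scale xs ys \<and> set ys \<subseteq> V \<times> W \<and> distinct (map fst ys) \<and>
    independent (fst ` set ys)"
  using assms(2)
proof (induction xs)
  case Nil
  show ?case by (intro exI[of _ "[]"]) (auto simp: tensor_eq.refl independent_empty)
next
  case (Cons p xs)
  obtain a b where p: "p = (a, b)" "a \<in> V" "b \<in> W" using Cons.prems by auto
  obtain ys where ys: "tensor_eq scale xs ys" "set ys \<subseteq> V \<times> W" "distinct (map fst ys)"
    "independent (fst ` set ys)" using Cons by auto
  have eq: "tensor_eq scale (p # xs) ((a, b) # ys)" using tensor_eq_Cons ys(1) p(1) by blast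
  show ?case
  proof (cases "a \<in> span (fst ` set ys)")
    case False
    then have "a \<notin> fst ` set ys" "independent (insert a (fst ` set ys))"
      using ys(4) span_base independent_insertI by blast+
    then show ?thesis using eq ys p
      by (intro exI[of _ "(a, b) # ys"]) auto
  next
    case True
    then obtain c :: "'a \<Rightarrow> 'k" where "a = (\<Sum>v\<in>fst ` set ys. scale (c v) v)"
      by (auto simp: span_finite)
    also have "\<dots> = tensor_sum ys (\<lambda>a' b'. scale (c a') a')"
      by (rule tensor_sum_fst[OF ys(3), symmetric])
    finally have a: "a = tensor_sum ys (\<lambda>a' b'. scale (c a') a')" .
    let ?zs = "map (\<lambda>(a', b'). (a', b' + scale (c a') b)) ys"
    have m: "map fst ?zs = map fst ys" by auto
    have "tensor_eq scale (p # xs) ?zs"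
      using tensor_eq.trans[OF eq] tensor_eq_absorb[of ys c b] a by simp
    moreover have "set ?zs \<subseteq> V \<times> W"
      using ys(2) p(3) assms(1) by (auto intro!: subspace_add subspace_scale)
    moreover have "fst ` set ?zs = fst ` set ys" using m by (metis set_map)
    moreover have "distinct (map fst ?zs)" using m ys(3) by metis
    ultimately show ?thesis using ys(4) by (intro exI[of _ ?zs]) metis
  qed
qed

lemma dual_functional:
  assumes "independent (fst ` set ys)" "distinct (map fst ys)" "(a, b) \<in> set ys"
  obtains f where "functional f" "tensor_sum ys (\<lambda>u v. scale (f u) v) = b"
proof -
  obtain f where f: "functional f" "\<forall>x\<in>fst ` set ys. f x = (if x = a then 1 else 0)"
    using dual.linear_independent_extend[OF assms(1), of "\<lambda>x. if x = a then 1 else 0"] by blast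
  have "tensor_sum zs (\<lambda>u v. scale (f u) v) = (if (a, b) \<in> set zs then b else 0)"
    if "set zs \<subseteq> set ys" "distinct (map fst zs)" for zs
    using that
  proof (induction zs)
    case (Cons p zs)
    have "f (fst p) = (if fst p = a then 1 else 0)" using f(2) Cons.prems by auto
    moreover have "p = (a, b)" if "fst p = a"
      using that Cons.prems(1) assms(2,3) by (metis eq_key_imp_eq_value list.set_intros(1) prod.collapse subset_eq)
    moreover have "(a, b) \<notin> set zs" if "fst p = a"
      using that Cons.prems(2) by (auto simp: image_iff)
    ultimately show ?case using Cons by (cases "fst p = a") auto
  qed simp
  from this[of ys] f(1) assms(2,3) that show ?thesis by auto
qed

text \<open>
  The difference of the two sides has a representation with independent left factors.  A functional
  dual to one of them evaluates the difference to the corresponding right factor, which therefore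
  vanishes.
\<close>

lemma tensor_eqI_functionals:
  assumes "\<And>f. functional f \<Longrightarrow>
    tensor_sum xs (\<lambda>a b. scale (f a) b) = tensor_sum ys (\<lambda>a b. scale (f a) b)"
  shows "tensor_eq scale xs ys"
proof -
  let ?N = "map (\<lambda>(a, b). (- a, b)) ys"
  have bil: "bilinear_on UNIV (\<lambda>a b. scale (f a) b)" if "functional f" for f
    using that by (auto simp: bilinear_on_def linear_on_def functional_add functional_scale algebra_simps)
  obtain zs where zs: "tensor_eq scale (xs @ ?N) zs" "distinct (map fst zs)" "independent (fst ` set zs)"
    using tensor_independent_representation[OF subspace_UNIV, of "xs @ ?N" UNIV] by auto
  have N: "tensor_sum ?N (\<lambda>a b. scale (f a) b) = - tensor_sum ys (\<lambda>a b. scale (f a) b)"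
    if "functional f" for f
    using that by (induction ys) (auto simp: functional_minus)
  have z: "tensor_sum zs (\<lambda>a b. scale (f a) b) = 0" if "functional f" for f
    using tensor_eq_sum_global[OF zs(1) bil[OF that]] N[OF that] assms[OF that] by simp
  have "snd q = 0" if "q \<in> set zs" for q
    using dual_functional[OF zs(3,2), of "fst q" "snd q"] that z by (metis prod.collapse)
  then have "tensor_eq scale zs []"
  proof (induction zs)
    case (Cons q zs)
    then have "tensor_eq scale ([q] @ zs) ([] @ [])"
      using tensor_eq_zero_right[of "fst q"] by (intro tensor_eq.append) (auto, metis prod.collapse)
    then show ?case by simp
  qed (simp add: tensor_eq.refl)
  with zs(1) have "tensor_eq scale (xs @ ?N) []" using tensor_eq.trans by blast
  then have 1: "tensor_eq scale ((xs @ ?N) @ ys) ([] @ ys)"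
    by (rule tensor_eq.append[OF _ tensor_eq.refl])
  have "tensor_eq scale (xs @ (?N @ ys)) (xs @ [])"
    by (rule tensor_eq.append[OF tensor_eq.refl tensor_eq_cancel])
  then show ?thesis using 1 tensor_eq.trans tensor_eq.sym by fastforce
qed

lemma tensor_eq_map:
  assumes p: "Vector_Spaces.linear scale scale p" and eq: "tensor_eq scale xs ys"
  shows "tensor_eq scale (map (\<lambda>(a, b). (p a, p b)) xs) (map (\<lambda>(a, b). (p a, p b)) ys)"
  using eq
proof (induction rule: tensor_eq.induct)
  case (trans xs ys zs)
  then show ?case using tensor_eq.trans by blast
qed (simp_all add: endo.linear_add[OF p] endo.linear_scale[OF p] endo.linear_0[OF p]
    tensor_eq.refl tensor_eq.sym tensor_eq.append tensor_eq.comm tensor_eq.zero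
    tensor_eq.add_left tensor_eq.add_right tensor_eq.balanced)

lemma tensor3_eq_map:
  assumes p: "Vector_Spaces.linear scale scale p" and eq: "tensor3_eq scale xs ys"
  shows "tensor3_eq scale (map (\<lambda>(a, b, d). (p a, p b, p d)) xs) (map (\<lambda>(a, b, d). (p a, p b, p d)) ys)"
  using eq
proof (induction rule: tensor3_eq.induct)
  case (trans xs ys zs)
  then show ?case using tensor3_eq.trans by blast
qed (simp_all add: endo.linear_add[OF p] endo.linear_scale[OF p] endo.linear_0[OF p]
    tensor3_eq.refl tensor3_eq.sym tensor3_eq.append tensor3_eq.comm tensor3_eq.zero
    tensor3_eq.add1 tensor3_eq.add2 tensor3_eq.add3 tensor3_eq.balanced12 tensor3_eq.balanced23)

lemma tensor3_eq_zero_middle: "tensor3_eq scale [(a, 0, d)] []"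
proof -
  have "tensor3_eq scale [(scale 0 a, 0, d)] [(a, scale 0 0, d)]" by (rule tensor3_eq.balanced12)
  then have "tensor3_eq scale [(0, 0, d)] [(a, 0, d)]" by simp
  then show ?thesis using tensor3_eq.trans tensor3_eq.sym tensor3_eq.zero by blast
qed

lemma tensor3_eq_tensor_left:
  assumes "tensor_eq scale xs ys"
  shows "tensor3_eq scale (map (\<lambda>(a, b). (a, b, d)) xs) (map (\<lambda>(a, b). (a, b, d)) ys)"
  using assms
proof (induction rule: tensor_eq.induct)
  case (trans xs ys zs)
  then show ?case using tensor3_eq.trans by blast
qed (simp_all add: tensor3_eq.refl tensor3_eq.sym tensor3_eq.append tensor3_eq.comm tensor3_eq.zero
    tensor3_eq.add1 tensor3_eq.add2 tensor3_eq.balanced12)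

lemma tensor3_eq_tensor_right:
  assumes "tensor_eq scale xs ys"
  shows "tensor3_eq scale (map (\<lambda>(b, d). (a, b, d)) xs) (map (\<lambda>(b, d). (a, b, d)) ys)"
  using assms
proof (induction rule: tensor_eq.induct)
  case (trans xs ys zs)
  then show ?case using tensor3_eq.trans by blast
qed (simp_all add: tensor3_eq.refl tensor3_eq.sym tensor3_eq.append tensor3_eq.comm tensor3_eq_zero_middle
    tensor3_eq.add2 tensor3_eq.add3 tensor3_eq.balanced23)

lemma tensor3_eq_concat:
  assumes "\<And>z. z \<in> set zs \<Longrightarrow> tensor3_eq scale (f z) (g z)"
  shows "tensor3_eq scale (concat (map f zs)) (concat (map g zs))"
  using assms by (induction zs) (auto intro: tensor3_eq.refl tensor3_eq.append)

lemma projection_with_kernel: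
  assumes "subspace I" "subspace W" "I \<subseteq> W"
  obtains p where "Vector_Spaces.linear scale scale p" "p ` W \<subseteq> W" "\<forall>x\<in>W. p (p x) = p x"
    "{x \<in> W. p x = 0} = I"
proof -
  obtain B0 where B0: "B0 \<subseteq> I" "independent B0" "I \<subseteq> span B0"
    using maximal_independent_subset by blast
  obtain B where B: "B0 \<subseteq> B" "B \<subseteq> W" "independent B" "W \<subseteq> span B"
    using maximal_independent_subset_extend[of B0 W] B0 assms(3) by (metis order_trans)
  obtain p where p: "Vector_Spaces.linear scale scale p" "\<forall>x\<in>B. p x = (if x \<in> B0 then 0 else x)"
    using endo.linear_independent_extend[OF B(3), of "\<lambda>x. if x \<in> B0 then 0 else x"] by blast
  have sB: "span B = W" using B assms(2) by (simp add: span_subspace)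
  have sB0: "span B0 = I" using B0 assms(1) by (simp add: span_subspace)
  have pW: "p x \<in> span (B - B0)" if "x \<in> W" for x
  proof -
    have "p ` span B = span (p ` B)" by (rule endo.linear_span_image[OF p(1), symmetric])
    also have "\<dots> \<subseteq> span (B - B0)"
      using p(2) by (intro span_minimal subspace_span) (auto intro: span_base span_zero)
    finally show ?thesis using that sB by auto
  qed
  have fixed: "p x = x" if "x \<in> span (B - B0)" for x
    using endo.linear_eq_on_span[OF p(1) linear_id, of "B - B0" x] p(2) that by auto
  have zero: "p x = 0" if "x \<in> I" for x
  proof (rule endo.linear_eq_0_on_span[OF p(1)])
    show "x \<in> span B0" using that sB0 by simp
    show "p b = 0" if "b \<in> B0" for b using that p(2) B(1) by auto
  qed
  have sub: "span (B - B0) \<subseteq> W" using sB span_mono[of "B - B0" B] by auto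
  have "x \<in> I" if x: "x \<in> W" "p x = 0" for x
  proof -
    have "x \<in> span (B0 \<union> (B - B0))" using x(1) sB B(1) by (simp add: Un_absorb1)
    then obtain u v where uv: "x = u + v" "u \<in> span B0" "v \<in> span (B - B0)"
      unfolding span_Un by blast
    then have "p x = v" using zero sB0 fixed endo.linear_add[OF p(1)] by simp
    with uv x(2) sB0 show ?thesis by simp
  qed
  then have "{x \<in> W. p x = 0} = I" using zero assms(3) by blast
  moreover have "p ` W \<subseteq> W" using pW sub by auto
  moreover have "\<forall>x\<in>W. p (p x) = p x" using pW fixed by simp
  ultimately show ?thesis using that p(1) by blast
qed

text \<open>
  The ambient space may have infinite dimension; only \<open>W\<close> is finite-dimensional.  The image of a basis
  of \<open>W\<close> is independent and as large as the basis, hence spans \<open>W\<close>.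
\<close>

lemma injective_endomorphism_surjective:
  assumes "finite E" "subspace W" "W \<subseteq> span E"
    and g: "Vector_Spaces.linear scale scale g" "g ` W \<subseteq> W" "\<And>x. x \<in> W \<Longrightarrow> g x = 0 \<Longrightarrow> x = 0"
  shows "g ` W = W"
proof -
  obtain B where B: "B \<subseteq> W" "independent B" "W \<subseteq> span B"
    using maximal_independent_subset by blast
  have sB: "span B = W" using B assms(2) by (simp add: span_subspace)
  have fB: "finite B" using independent_span_bound[OF assms(1) B(2)] B(1) assms(3) by blast
  have inj: "inj_on g W"
    using g assms(2) by (intro inj_onI) (metis endo.linear_diff eq_iff_diff_eq_0 subspace_diff)
  have ind: "independent (g ` B)"
    using endo.linear_independent_injective_image[OF g(1) B(2)] inj sB by simp
  have card: "card (g ` B) = card B" using inj B(1) by (meson card_image inj_on_subset)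
  have "W \<subseteq> span (g ` B)"
  proof (rule ccontr)
    assume "\<not> W \<subseteq> span (g ` B)"
    then obtain w where w: "w \<in> W" "w \<notin> span (g ` B)" by blast
    then have "independent (insert w (g ` B))" using ind by (intro independent_insertI)
    moreover have "insert w (g ` B) \<subseteq> span B" using w(1) sB g(2) B(1) by auto
    ultimately have "card (insert w (g ` B)) \<le> card B" using independent_span_bound[OF fB] by blast
    moreover have "w \<notin> g ` B" using w(2) span_superset by blast
    ultimately show False using card fB by simp
  qed
  also have "span (g ` B) = g ` W" using endo.linear_span_image[OF g(1)] sB by simp
  finally show ?thesis using g(2) by blast
qed

end

section \<open>Sweedler sums in a Hopf algebra\<close>

text \<open>
  Linearity of an expression in each Sweedler component is proved by descending through the
  operations with \<open>lin_intros\<close>; the rules \<open>closed\<close> keep the arguments in the carrier.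
\<close>

named_theorems lin_intros
named_theorems closed

text \<open>
  If \<open>z\<close> is a central idempotent and \<open>Hz\<close> is a quotient Hopf algebra, these are the coinvariants of
  the projection \<open>x \<mapsto> xz\<close>, because then \<open>x\<^sub>1 \<otimes> \<pi>(x\<^sub>2) = x \<otimes> 1\<close> reads \<open>x\<^sub>1 \<otimes> x\<^sub>2 z = x \<otimes> z\<close>.
\<close>

definition coinvariants :: "('k::field, 'a::ab_group_add) hopf \<Rightarrow> 'a \<Rightarrow> 'a set" where
  "coinvariants H z = {x \<in> hcarrier H.
     tensor_eq (hscale H) (map (\<lambda>(a, b). (a, b \<cdot>\<^bsub>H\<^esub> z)) (\<Delta>\<^bsub>H\<^esub> x)) [(x, z)]}"

sublocale unital_algebra \<subseteq> tensor_space "hscale H"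
  by unfold_locales

context hopf_algebra
begin

abbreviation "V \<equiv> hcarrier H"
abbreviation "S \<equiv> hantipode H"
abbreviation "lin \<equiv> linear_on V"
abbreviation "bilin \<equiv> bilinear_on V"
abbreviation "sw x B \<equiv> tensor_sum (\<Delta> x) B"

lemma comult_fst: "(a, b) \<in> set (\<Delta> x) \<Longrightarrow> x \<in> V \<Longrightarrow> a \<in> V"
  and comult_snd: "(a, b) \<in> set (\<Delta> x) \<Longrightarrow> x \<in> V \<Longrightarrow> b \<in> V"
  using comult_closed by blast+

lemmas closed_rules = mult_closed unit_closed antipode_closed comult_fst comult_snd
  subspace_add[OF carrier_subspace] subspace_scale[OF carrier_subspace]
  subspace_diff[OF carrier_subspace] subspace_0[OF carrier_subspace]
  tensor_sum_in[OF carrier_subspace]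

declare closed_rules [closed] carrier_subspace [closed]

lemma antipode_linear: "lin S"
  by (intro linear_onI antipode_add antipode_scale)

lemma lin_antipode [lin_intros]: "lin g \<Longrightarrow> (\<And>x. x \<in> V \<Longrightarrow> g x \<in> V) \<Longrightarrow> lin (\<lambda>x. S (g x))"
  by (simp add: linear_on_def antipode_add antipode_scale)

lemma lin_mult_left [lin_intros]:
  "lin g \<Longrightarrow> (\<And>x. x \<in> V \<Longrightarrow> g x \<in> V) \<Longrightarrow> y \<in> V \<Longrightarrow> lin (\<lambda>x. g x \<cdot> y)"
  by (simp add: linear_on_def mult_add_left mult_scale_left)

lemma lin_mult_right [lin_intros]:
  "lin g \<Longrightarrow> (\<And>x. x \<in> V \<Longrightarrow> g x \<in> V) \<Longrightarrow> y \<in> V \<Longrightarrow> lin (\<lambda>x. y \<cdot> g x)"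
  by (simp add: linear_on_def mult_add_right mult_scale_right)

lemma lin_counit [lin_intros]:
  "lin g \<Longrightarrow> (\<And>x. x \<in> V \<Longrightarrow> g x \<in> V) \<Longrightarrow> lin (\<lambda>x. \<epsilon> (g x) \<odot> v)"
  by (simp add: linear_on_def counit_add counit_scale scale_left_distrib)

lemma sw_add: "bilin B \<Longrightarrow> x \<in> V \<Longrightarrow> y \<in> V \<Longrightarrow> sw (x + y) B = sw x B + sw y B"
  using tensor_eq_sum[OF comult_add carrier_subspace, of x y B]
  by (simp add: comult_closed closed)

lemma sw_scale:
  assumes "bilin B" "x \<in> V"
  shows "sw (c \<odot> x) B = c \<odot> sw x B"
proof -
  have "sw (c \<odot> x) B = tensor_sum (map (\<lambda>(a, b). (c \<odot> a, b)) (\<Delta> x)) B"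
    using assms by (intro tensor_eq_sum[OF comult_scale carrier_subspace])
      (auto simp: closed comult_closed)
  also have "\<dots> = sw x (\<lambda>a b. B (c \<odot> a) b)" by (rule tensor_sum_map)
  also have "\<dots> = sw x (\<lambda>a b. c \<odot> B a b)"
    using assms by (intro tensor_sum_cong) (auto simp: bilinear_on_def linear_on_def closed)
  finally show ?thesis by (simp add: scale_tensor_sum)
qed

lemma lin_sw [lin_intros]:
  "bilin B \<Longrightarrow> lin g \<Longrightarrow> (\<And>x. x \<in> V \<Longrightarrow> g x \<in> V) \<Longrightarrow> lin (\<lambda>x. sw (g x) B)"
  by (simp add: linear_on_def sw_add sw_scale)

lemmas [lin_intros] = linear_on_ident linear_on_scale_const linear_on_sum
  bilinear_onI trilinear_onI

lemma sw_mult: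
  assumes "bilin B" "x \<in> V" "y \<in> V"
  shows "sw (x \<cdot> y) B = sw x (\<lambda>a b. sw y (\<lambda>c d. B (a \<cdot> c) (b \<cdot> d)))"
proof -
  have "sw (x \<cdot> y) B = tensor_sum [(a \<cdot> c, b \<cdot> d). (a, b) \<leftarrow> \<Delta> x, (c, d) \<leftarrow> \<Delta> y] B"
    using assms by (intro tensor_eq_sum[OF comult_mult carrier_subspace])
      (auto simp: closed comult_closed)
  then show ?thesis by (simp add: tensor_sum_product)
qed

lemma sw_unit: "bilin B \<Longrightarrow> sw \<one> B = B \<one> \<one>"
  using tensor_eq_sum[OF comult_unit carrier_subspace, of B] comult_closed[OF unit_closed]
  by (auto simp: unit_closed)

lemma sw_coassoc:
  assumes "trilinear_on V T" "x \<in> V"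
  shows "sw x (\<lambda>u d. sw u (\<lambda>a b. T a b d)) = sw x (\<lambda>a v. sw v (\<lambda>b d. T a b d))"
proof -
  have "triple_sum [(a, b, d). (u, d) \<leftarrow> \<Delta> x, (a, b) \<leftarrow> \<Delta> u] T =
      triple_sum [(a, b, d). (a, v) \<leftarrow> \<Delta> x, (b, d) \<leftarrow> \<Delta> v] T"
    using assms by (intro tensor3_eq_sum[OF coassoc carrier_subspace])
      (auto simp: closed)
  then show ?thesis by (simp only: triple_sum_left triple_sum_right)
qed

lemma sw_counit_left: "lin g \<Longrightarrow> x \<in> V \<Longrightarrow> sw x (\<lambda>a b. \<epsilon> a \<odot> g b) = g x"
proof -
  assume g: "lin g" and x: "x \<in> V"
  have "g x = g (sw x (\<lambda>a b. \<epsilon> a \<odot> b))"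
    using counit_left[OF x] by (simp add: tensor_sum_def)
  also have "\<dots> = sw x (\<lambda>a b. g (\<epsilon> a \<odot> b))"
    using g x by (intro linear_on_tensor_sum_apply carrier_subspace) (auto simp: closed)
  also have "\<dots> = sw x (\<lambda>a b. \<epsilon> a \<odot> g b)"
    using g x by (intro tensor_sum_cong) (auto simp: linear_on_scale closed)
  finally show ?thesis by simp
qed

lemma sw_counit_right: "lin g \<Longrightarrow> x \<in> V \<Longrightarrow> sw x (\<lambda>a b. \<epsilon> b \<odot> g a) = g x"
proof -
  assume g: "lin g" and x: "x \<in> V"
  have "g x = g (sw x (\<lambda>a b. \<epsilon> b \<odot> a))"
    using counit_right[OF x] by (simp add: tensor_sum_def)
  also have "\<dots> = sw x (\<lambda>a b. g (\<epsilon> b \<odot> a))"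
    using g x by (intro linear_on_tensor_sum_apply carrier_subspace) (auto simp: closed)
  also have "\<dots> = sw x (\<lambda>a b. \<epsilon> b \<odot> g a)"
    using g x by (intro tensor_sum_cong) (auto simp: linear_on_scale closed)
  finally show ?thesis by simp
qed

lemma sw_antipode_left: "lin g \<Longrightarrow> x \<in> V \<Longrightarrow> sw x (\<lambda>a b. g (S a \<cdot> b)) = \<epsilon> x \<odot> g \<one>"
proof -
  assume g: "lin g" and x: "x \<in> V"
  have "sw x (\<lambda>a b. g (S a \<cdot> b)) = g (sw x (\<lambda>a b. S a \<cdot> b))"
    using g x by (intro linear_on_tensor_sum_apply[symmetric] carrier_subspace) (auto simp: closed)
  also have "sw x (\<lambda>a b. S a \<cdot> b) = \<epsilon> x \<odot> \<one>"
    using antipode_left[OF x] by (simp add: tensor_sum_def)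
  finally show ?thesis using g by (simp add: linear_on_scale unit_closed)
qed

lemma sw_antipode_right: "lin g \<Longrightarrow> x \<in> V \<Longrightarrow> sw x (\<lambda>a b. g (a \<cdot> S b)) = \<epsilon> x \<odot> g \<one>"
proof -
  assume g: "lin g" and x: "x \<in> V"
  have "sw x (\<lambda>a b. g (a \<cdot> S b)) = g (sw x (\<lambda>a b. a \<cdot> S b))"
    using g x by (intro linear_on_tensor_sum_apply[symmetric] carrier_subspace) (auto simp: closed)
  also have "sw x (\<lambda>a b. a \<cdot> S b) = \<epsilon> x \<odot> \<one>"
    using antipode_right[OF x] by (simp add: tensor_sum_def)
  finally show ?thesis using g by (simp add: linear_on_scale unit_closed)
qed

lemma counit_zero: "\<epsilon> 0 = 0"
  using counit_scale[OF unit_closed, of 0] by simp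

lemma counit_diff: "x \<in> V \<Longrightarrow> y \<in> V \<Longrightarrow> \<epsilon> (x - y) = \<epsilon> x - \<epsilon> y"
  using counit_add[of "x - y" y] by (simp add: closed)

lemma counit_tensor_sum:
  "(\<And>a b. (a, b) \<in> set xs \<Longrightarrow> B a b \<in> V) \<Longrightarrow> \<epsilon> (tensor_sum xs B) = tensor_sum xs (\<lambda>a b. \<epsilon> (B a b))"
proof (induction xs)
  case (Cons p xs)
  then have "tensor_sum xs B \<in> V" by (intro tensor_sum_in[OF carrier_subspace]) auto
  moreover have "B (fst p) (snd p) \<in> V" using Cons.prems[of "fst p" "snd p"] by simp
  ultimately show ?case using Cons by (simp add: counit_add)
qed (simp add: counit_zero)

lemma mult_diff_left: "x \<in> V \<Longrightarrow> y \<in> V \<Longrightarrow> z \<in> V \<Longrightarrow> (x - y) \<cdot> z = x \<cdot> z - y \<cdot> z"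
  using mult_add_left[of "x - y" y z] by (simp add: closed algebra_simps)

lemma mult_diff_right: "x \<in> V \<Longrightarrow> y \<in> V \<Longrightarrow> z \<in> V \<Longrightarrow> z \<cdot> (x - y) = z \<cdot> x - z \<cdot> y"
  using mult_add_right[of z "x - y" y] by (simp add: closed algebra_simps)

lemma mult_zero: "x \<in> V \<Longrightarrow> 0 \<cdot> x = 0" "x \<in> V \<Longrightarrow> x \<cdot> 0 = 0"
  using mult_diff_left[of x x x] mult_diff_right[of x x x] by simp_all

lemma antipode_unit: "S \<one> = \<one>"
proof -
  have "sw \<one> (\<lambda>a b. S a \<cdot> b) = S \<one> \<cdot> \<one>"
    by (rule sw_unit) (intro lin_intros; simp add: closed)
  then show ?thesis
    using sw_antipode_left[OF linear_on_ident unit_closed]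
    by (simp add: counit_unit unit_right closed)
qed

lemma counit_antipode:
  assumes x: "x \<in> V"
  shows "\<epsilon> (S x) = \<epsilon> x"
proof -
  have "\<epsilon> x = \<epsilon> (sw x (\<lambda>a b. S a \<cdot> b))"
    using sw_antipode_left[OF linear_on_ident x] by (simp add: counit_scale counit_unit closed)
  also have "\<dots> = sw x (\<lambda>a b. \<epsilon> (S a \<cdot> b))"
    using x by (intro counit_tensor_sum) (auto simp: closed)
  also have "\<dots> = sw x (\<lambda>a b. \<epsilon> (\<epsilon> b \<odot> S a))"
    using x by (intro tensor_sum_cong) (auto simp: counit_mult counit_scale closed)
  also have "\<dots> = \<epsilon> (sw x (\<lambda>a b. \<epsilon> b \<odot> S a))"
    using x by (intro counit_tensor_sum[symmetric]) (auto simp: closed)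
  also have "\<dots> = \<epsilon> (S x)"
    using x by (simp add: sw_counit_right antipode_linear)
  finally show ?thesis by simp
qed

text \<open>
  Both sides are convolution inverse to the multiplication map \<open>H \<otimes> H \<rightarrow> H\<close>.  Concretely, the sum of
  \<open>S(x\<^sub>1y\<^sub>1) x\<^sub>2y\<^sub>2 S(y\<^sub>3) S(x\<^sub>3)\<close> collapses to \<open>S(xy)\<close> from the right and to \<open>S(y)S(x)\<close> from the left.
\<close>

lemma antipode_mult:
  assumes x: "x \<in> V" and y: "y \<in> V"
  shows "S (x \<cdot> y) = S y \<cdot> S x"
proof -
  define T where "T x1 x2 x3 y1 y2 y3 = S (x1 \<cdot> y1) \<cdot> ((x2 \<cdot> y2) \<cdot> (S y3 \<cdot> S x3))" for x1 x2 x3 y1 y2 y3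
  have "sw x (\<lambda>x1 x'. sw x' (\<lambda>x2 x3. sw y (\<lambda>y1 y'. sw y' (\<lambda>y2 y3. T x1 x2 x3 y1 y2 y3))))
      = sw x (\<lambda>x1 x'. sw x' (\<lambda>x2 x3. sw y (\<lambda>y1 y'. \<epsilon> y' \<odot> (S (x1 \<cdot> y1) \<cdot> (x2 \<cdot> S x3)))))"
  proof (intro tensor_sum_cong)
    fix x1 x' x2 x3 y1 y'
    assume "(x1, x') \<in> set (\<Delta> x)" "(x2, x3) \<in> set (\<Delta> x')" "(y1, y') \<in> set (\<Delta> y)"
    then have m: "x1 \<in> V" "x2 \<in> V" "x3 \<in> V" "y1 \<in> V" "y' \<in> V"
      using x y by (meson comult_fst comult_snd)+
    have "sw y' (\<lambda>y2 y3. T x1 x2 x3 y1 y2 y3) =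
        sw y' (\<lambda>y2 y3. S (x1 \<cdot> y1) \<cdot> (x2 \<cdot> ((y2 \<cdot> S y3) \<cdot> S x3)))"
      using m by (intro tensor_sum_cong)
        (auto simp: T_def mult_assoc closed)
    also have "\<dots> = \<epsilon> y' \<odot> (S (x1 \<cdot> y1) \<cdot> (x2 \<cdot> (\<one> \<cdot> S x3)))"
      using m by (intro sw_antipode_right[where g = "\<lambda>z. S (x1 \<cdot> y1) \<cdot> (x2 \<cdot> (z \<cdot> S x3))"] lin_intros)
        (auto simp: closed)
    finally show "sw y' (\<lambda>y2 y3. T x1 x2 x3 y1 y2 y3) = \<epsilon> y' \<odot> (S (x1 \<cdot> y1) \<cdot> (x2 \<cdot> S x3))"
      using m by (simp add: unit_left closed)
  qed
  also have "\<dots> = sw x (\<lambda>x1 x'. sw x' (\<lambda>x2 x3. S (x1 \<cdot> y) \<cdot> (x2 \<cdot> S x3)))"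
    using x y by (intro tensor_sum_cong sw_counit_right lin_intros)
      (auto simp: closed)
  also have "\<dots> = sw x (\<lambda>x1 x'. \<epsilon> x' \<odot> (S (x1 \<cdot> y) \<cdot> \<one>))"
    using x y by (intro tensor_sum_cong sw_antipode_right[where g = "\<lambda>z. S (_ \<cdot> y) \<cdot> z"] lin_intros)
      (auto simp: closed)
  also have "\<dots> = S (x \<cdot> y) \<cdot> \<one>"
    using x y by (intro sw_counit_right lin_intros) (auto simp: closed)
  finally have 1: "sw x (\<lambda>x1 x'. sw x' (\<lambda>x2 x3. sw y (\<lambda>y1 y'. sw y' (\<lambda>y2 y3. T x1 x2 x3 y1 y2 y3))))
      = S (x \<cdot> y)" using x y by (simp add: unit_right closed)
  have tri: "trilinear_on V (\<lambda>y1 y2 y3. T x1 x2 x3 y1 y2 y3)"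
    if "x1 \<in> V" "x2 \<in> V" "x3 \<in> V" for x1 x2 x3
    unfolding T_def using that by (intro lin_intros) (auto simp: closed)
  have "sw x (\<lambda>x1 x'. sw x' (\<lambda>x2 x3. sw y (\<lambda>y1 y'. sw y' (\<lambda>y2 y3. T x1 x2 x3 y1 y2 y3))))
     = sw x (\<lambda>x1 x'. sw x' (\<lambda>x2 x3. sw y (\<lambda>w y3. sw w (\<lambda>y1 y2. T x1 x2 x3 y1 y2 y3))))"
    using x y by (intro tensor_sum_cong sw_coassoc[symmetric] tri) (auto simp: closed)
  also have "\<dots> = sw x (\<lambda>u x3. sw u (\<lambda>x1 x2. sw y (\<lambda>w y3. sw w (\<lambda>y1 y2. T x1 x2 x3 y1 y2 y3))))"
    unfolding T_def using x y by (intro sw_coassoc[symmetric] lin_intros) (auto simp: closed)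
  also have "\<dots> = sw x (\<lambda>u x3. sw y (\<lambda>w y3. sw u (\<lambda>x1 x2. sw w (\<lambda>y1 y2. T x1 x2 x3 y1 y2 y3))))"
    by (intro tensor_sum_cong tensor_sum_swap)
  also have "\<dots> = sw x (\<lambda>u x3. sw y (\<lambda>w y3. \<epsilon> u \<odot> (\<epsilon> w \<odot> (S y3 \<cdot> S x3))))"
  proof (intro tensor_sum_cong)
    fix u x3 w y3 assume "(u, x3) \<in> set (\<Delta> x)" "(w, y3) \<in> set (\<Delta> y)"
    then have m: "u \<in> V" "x3 \<in> V" "w \<in> V" "y3 \<in> V" using x y by (meson comult_fst comult_snd)+
    have "sw u (\<lambda>x1 x2. sw w (\<lambda>y1 y2. T x1 x2 x3 y1 y2 y3)) =
        sw (u \<cdot> w) (\<lambda>c d. S c \<cdot> (d \<cdot> (S y3 \<cdot> S x3)))"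
      unfolding T_def using m
      by (intro sw_mult[where B = "\<lambda>c d. S c \<cdot> (d \<cdot> (S y3 \<cdot> S x3))", symmetric] lin_intros) (auto simp: closed)
    also have "\<dots> = sw (u \<cdot> w) (\<lambda>c d. (S c \<cdot> d) \<cdot> (S y3 \<cdot> S x3))"
      using m by (intro tensor_sum_cong) (auto simp: mult_assoc closed)
    also have "\<dots> = \<epsilon> (u \<cdot> w) \<odot> (\<one> \<cdot> (S y3 \<cdot> S x3))"
      using m by (intro sw_antipode_left[where g = "\<lambda>z. z \<cdot> (S y3 \<cdot> S x3)"] lin_intros) (auto simp: closed)
    finally show "sw u (\<lambda>x1 x2. sw w (\<lambda>y1 y2. T x1 x2 x3 y1 y2 y3)) = \<epsilon> u \<odot> (\<epsilon> w \<odot> (S y3 \<cdot> S x3))"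
      using m by (simp add: counit_mult unit_left closed)
  qed
  also have "\<dots> = sw x (\<lambda>u x3. \<epsilon> u \<odot> sw y (\<lambda>w y3. \<epsilon> w \<odot> (S y3 \<cdot> S x3)))"
    by (simp add: scale_tensor_sum)
  also have "\<dots> = sw x (\<lambda>u x3. \<epsilon> u \<odot> (S y \<cdot> S x3))"
    using x y by (intro tensor_sum_cong arg_cong[where f = "\<lambda>z. _ \<odot> z"] sw_counit_left lin_intros)
      (auto simp: closed)
  also have "\<dots> = S y \<cdot> S x"
    using x y by (intro sw_counit_left lin_intros) (auto simp: closed)
  finally show ?thesis using 1 by simp
qed

lemma unital_subalgebraD:
  assumes "unital_subalgebra H K"
  shows "K \<subseteq> V" "subspace K" "\<one> \<in> K" "\<And>x y. x \<in> K \<Longrightarrow> y \<in> K \<Longrightarrow> x \<cdot> y \<in> K"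
  using assms by (auto simp: unital_subalgebra_def)

lemma bilin_functional: "functional f \<Longrightarrow> bilin (\<lambda>a b. f a \<odot> b)"
  by (intro lin_intros linear_on_functional)

lemma tensor_inE:
  assumes "tensor_in (\<odot>) (\<Delta> x) U W" "x \<in> V" "U \<subseteq> V" "W \<subseteq> V"
  obtains ys where "set ys \<subseteq> U \<times> W" "tensor_eq (\<odot>) (\<Delta> x) ys" "\<And>B. bilin B \<Longrightarrow> sw x B = tensor_sum ys B"
proof -
  obtain ys where ys: "set ys \<subseteq> U \<times> W" "tensor_eq (\<odot>) (\<Delta> x) ys"
    using assms(1) by (auto simp: tensor_in_def)
  then have "sw x B = tensor_sum ys B" if "bilin B" for B
    using that assms by (intro tensor_eq_sum[OF _ carrier_subspace]) (auto simp: comult_closed closed)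
  with ys that show ?thesis by blast
qed

section \<open>Coinvariants\<close>

lemma coinvariants_sum:
  assumes "x \<in> coinvariants H z" "z \<in> V" "bilin B"
  shows "sw x (\<lambda>a b. B a (b \<cdot> z)) = B x z"
proof -
  have x: "x \<in> V" and eq: "tensor_eq (\<odot>) (map (\<lambda>(a, b). (a, b \<cdot> z)) (\<Delta> x)) [(x, z)]"
    using assms(1) by (auto simp: coinvariants_def)
  have "tensor_sum (map (\<lambda>(a, b). (a, b \<cdot> z)) (\<Delta> x)) B = tensor_sum [(x, z)] B"
    using x assms by (intro tensor_eq_sum[OF eq carrier_subspace]) (auto simp: closed)
  then show ?thesis by (simp add: tensor_sum_map)
qed

lemma coinvariantsI:
  assumes "x \<in> V" "\<And>f. functional f \<Longrightarrow> sw x (\<lambda>a b. f a \<odot> (b \<cdot> z)) = f x \<odot> z"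
  shows "x \<in> coinvariants H z"
  using assms by (auto simp: coinvariants_def tensor_sum_map intro!: tensor_eqI_functionals)

lemma coinvariants_subset: "coinvariants H z \<subseteq> V"
  by (auto simp: coinvariants_def)

text \<open>
  In \<open>x\<^sub>1 \<otimes> x\<^sub>2L = x \<otimes> L\<close> apply the coproduct to the right factor and multiply the middle factor by
  \<open>S(x\<^sub>1)\<close> from the left: the result is \<open>L\<^sub>1 \<otimes> xL\<^sub>2 = S(x)L\<^sub>1 \<otimes> L\<^sub>2\<close>.
\<close>

lemma coinvariant_twist:
  assumes L: "L \<in> V" and x: "x \<in> coinvariants H L" and f: "functional f"
  shows "sw L (\<lambda>a b. f a \<odot> (x \<cdot> b)) = sw L (\<lambda>a b. f (S x \<cdot> a) \<odot> b)"
proof -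
  note lf = linear_on_functional[OF f]
  have xV: "x \<in> V" using x by (auto simp: coinvariants_def)
  have "sw L (\<lambda>a b. f (S x \<cdot> a) \<odot> b) = sw x (\<lambda>x1 x2. sw (x2 \<cdot> L) (\<lambda>c d. f (S x1 \<cdot> c) \<odot> d))"
    using L xV
    by (intro coinvariants_sum[OF x L, where B = "\<lambda>u v. sw v (\<lambda>c d. f (S u \<cdot> c) \<odot> d)", symmetric] lin_intros lf)
      (auto simp: closed)
  also have "\<dots> = sw x (\<lambda>x1 x2. sw x2 (\<lambda>y z. sw L (\<lambda>a b. f (S x1 \<cdot> (y \<cdot> a)) \<odot> (z \<cdot> b))))"
    using L xV
    by (intro tensor_sum_cong sw_mult[where B = "\<lambda>c d. f (S _ \<cdot> c) \<odot> d"] lin_intros lf) (auto simp: closed)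
  also have "\<dots> = sw x (\<lambda>u z. sw u (\<lambda>x1 y. sw L (\<lambda>a b. f (S x1 \<cdot> (y \<cdot> a)) \<odot> (z \<cdot> b))))"
    using L xV by (intro sw_coassoc[symmetric] lin_intros lf) (auto simp: closed)
  also have "\<dots> = sw x (\<lambda>u z. sw L (\<lambda>a b. sw u (\<lambda>x1 y. f (S x1 \<cdot> (y \<cdot> a)) \<odot> (z \<cdot> b))))"
    by (intro tensor_sum_cong tensor_sum_swap)
  also have "\<dots> = sw x (\<lambda>u z. sw L (\<lambda>a b. \<epsilon> u \<odot> (f a \<odot> (z \<cdot> b))))"
  proof (intro tensor_sum_cong)
    fix u z a b assume "(u, z) \<in> set (\<Delta> x)" "(a, b) \<in> set (\<Delta> L)"
    then have m: "u \<in> V" "z \<in> V" "a \<in> V" "b \<in> V" using xV L by (auto simp: closed)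
    have "sw u (\<lambda>x1 y. f (S x1 \<cdot> (y \<cdot> a)) \<odot> (z \<cdot> b)) = sw u (\<lambda>x1 y. f ((S x1 \<cdot> y) \<cdot> a) \<odot> (z \<cdot> b))"
      using m by (intro tensor_sum_cong) (auto simp: closed mult_assoc)
    also have "\<dots> = \<epsilon> u \<odot> (f (\<one> \<cdot> a) \<odot> (z \<cdot> b))"
      using m by (intro sw_antipode_left[where g = "\<lambda>t. f (t \<cdot> a) \<odot> (z \<cdot> b)"] lin_intros lf) (auto simp: closed)
    finally show "sw u (\<lambda>x1 y. f (S x1 \<cdot> (y \<cdot> a)) \<odot> (z \<cdot> b)) = \<epsilon> u \<odot> (f a \<odot> (z \<cdot> b))"
      using m by (simp add: unit_left)
  qed
  also have "\<dots> = sw x (\<lambda>u z. \<epsilon> u \<odot> sw L (\<lambda>a b. f a \<odot> (z \<cdot> b)))"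
    by (simp only: scale_tensor_sum)
  also have "\<dots> = sw L (\<lambda>a b. f a \<odot> (x \<cdot> b))"
    using L xV by (intro sw_counit_left lin_intros) (auto simp: closed)
  finally show ?thesis by simp
qed

text \<open>
  Let \<open>U\<close> consist of all \<open>f(L\<^sub>1)L\<^sub>2\<close> with \<open>f\<close> a functional; it is contained in \<open>W\<close>.  By the twist lemma
  \<open>U\<close> is stable under left multiplication by coinvariants.  Since the elements of \<open>U\<close> include the
  right factors of \<open>L\<close> and the antipodes of the left factors are coinvariant, \<open>1 = S(L\<^sub>1)L\<^sub>2\<close> lies in
  \<open>U\<close>, and so does every coinvariant \<open>x = x1\<close>.
\<close>

lemma coinvariants_in_support:
  assumes L: "L \<in> V" "\<epsilon> L = 1"
    and W: "subspace W" "W \<subseteq> V" and A: "A \<subseteq> V" "\<And>a. a \<in> A \<Longrightarrow> S a \<in> coinvariants H L"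
    and in_AW: "tensor_in (\<odot>) (\<Delta> L) A W"
  shows "coinvariants H L \<subseteq> W"
proof -
  obtain ys where ys: "set ys \<subseteq> A \<times> W" "tensor_eq (\<odot>) (\<Delta> L) ys"
    using in_AW by (auto simp: tensor_in_def)
  obtain zs where zs: "tensor_eq (\<odot>) ys zs" "set zs \<subseteq> A \<times> W" "distinct (map fst zs)" "independent (fst ` set zs)"
    using tensor_independent_representation[OF W(1) ys(1)] by auto
  have L_zs: "sw L B = tensor_sum zs B" if "bilin B" for B
    using tensor_eq.trans[OF ys(2) zs(1)] that zs(2) W(2) A(1)
    by (intro tensor_eq_sum[OF _ carrier_subspace]) (auto simp: comult_closed L)
  define U where "U = {sw L (\<lambda>a b. f a \<odot> b) | f. functional f}"
  have U_I: "sw L (\<lambda>a b. f a \<odot> b) \<in> U" if "functional f" for f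
    using that by (auto simp: U_def)
  have subU: "subspace U"
  proof (rule subspaceI)
    have "functional (\<lambda>_. 0)" by (rule functionalI) auto
    then show "0 \<in> U" using U_I[of "\<lambda>_. 0"] by simp
  next
    fix x y assume "x \<in> U" "y \<in> U"
    then obtain f g where fg: "functional f" "functional g" "x = sw L (\<lambda>a b. f a \<odot> b)" "y = sw L (\<lambda>a b. g a \<odot> b)"
      by (auto simp: U_def)
    then have "functional (\<lambda>v. f v + g v)"
      by (intro functionalI) (auto simp: functional_add functional_scale algebra_simps)
    from U_I[OF this] show "x + y \<in> U"
      using fg by (simp add: scale_left_distrib tensor_sum_add)
  next
    fix c x assume "x \<in> U"
    then obtain f where f: "functional f" "x = sw L (\<lambda>a b. f a \<odot> b)" by (auto simp: U_def)
    then have "functional (\<lambda>v. c * f v)"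
      by (intro functionalI) (auto simp: functional_add functional_scale algebra_simps)
    from U_I[OF this] show "c \<odot> x \<in> U"
      using f by (simp add: scale_tensor_sum)
  qed
  have stable: "x \<cdot> u \<in> U" if x: "x \<in> coinvariants H L" and u: "u \<in> U" for x u
  proof -
    obtain f where f: "functional f" "u = sw L (\<lambda>a b. f a \<odot> b)" using u by (auto simp: U_def)
    obtain P where P: "Vector_Spaces.linear (\<odot>) (\<odot>) P" "\<And>x. x \<in> V \<Longrightarrow> P x = x" "\<And>x. P x \<in> V"
      using linear_projection_exists[OF carrier_subspace] by metis
    have xV: "x \<in> V" using x coinvariants_subset by blast
    have "x \<cdot> u = sw L (\<lambda>a b. x \<cdot> (f a \<odot> b))"
      unfolding f(2) using xV L
      by (intro linear_on_tensor_sum_apply[OF carrier_subspace] lin_intros) (auto simp: closed)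
    also have "\<dots> = sw L (\<lambda>a b. f a \<odot> (x \<cdot> b))"
      using xV L by (intro tensor_sum_cong) (auto simp: mult_scale_right closed)
    also have "\<dots> = sw L (\<lambda>a b. f (S x \<cdot> a) \<odot> b)" by (rule coinvariant_twist[OF L(1) x f(1)])
    also have "\<dots> = sw L (\<lambda>a b. f (S x \<cdot> P a) \<odot> b)"
      using L P by (intro tensor_sum_cong) (auto simp: closed)
    also have "\<dots> \<in> U"
      using xV by (intro U_I functional_comp[OF f(1) P(1,3), of "\<lambda>v. S x \<cdot> v"] lin_intros) (auto simp: closed)
    finally show ?thesis .
  qed
  have snd_U: "b \<in> U" if ab: "(a, b) \<in> set zs" for a b
  proof -
    obtain f where f: "functional f" "tensor_sum zs (\<lambda>u v. f u \<odot> v) = b"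
      using dual_functional[OF zs(4,3) ab] by blast
    with U_I[OF f(1)] L_zs[OF bilin_functional[OF f(1)]] show ?thesis by simp
  qed
  have "\<one> = sw L (\<lambda>a b. S a \<cdot> b)"
    using sw_antipode_left[OF linear_on_ident L(1)] L(2) by simp
  also have "\<dots> = tensor_sum zs (\<lambda>a b. S a \<cdot> b)"
    by (intro L_zs lin_intros) (auto simp: closed)
  also have "\<dots> \<in> U"
    using zs(2) A(2) by (intro tensor_sum_in[OF subU] stable snd_U) auto
  finally have one: "\<one> \<in> U" .
  show ?thesis
  proof
    fix x assume x: "x \<in> coinvariants H L"
    then have "x \<in> V" using coinvariants_subset by blast
    then have "x \<in> U" using stable[OF x one] by (simp add: unit_right)
    then obtain f where f: "functional f" "x = tensor_sum zs (\<lambda>a b. f a \<odot> b)"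
      using L_zs[OF bilin_functional] by (auto simp: U_def)
    then show "x \<in> W" using zs(2) by (auto intro!: tensor_sum_in W(1) subspace_scale)
  qed
qed

section \<open>The Hopf center\<close>

lemma center_of_iff: "z \<in> center_of H V \<longleftrightarrow> z \<in> V \<and> (\<forall>x\<in>V. z \<cdot> x = x \<cdot> z)"
  by (auto simp: center_of_def)

lemma scalars_hopf_subalgebra: "hopf_subalgebra H (scalars H)"
proof -
  have sub: "subspace (scalars H)"
    unfolding scalars_def span_singleton[symmetric] by (rule subspace_span)
  have one: "\<one> \<in> scalars H" unfolding scalars_def by (rule range_eqI[of _ _ 1]) simp
  have "unital_subalgebra H (scalars H)"
    unfolding unital_subalgebra_def using sub one
    by (auto simp: scalars_def mult_scale_left mult_scale_right unit_left closed)
  moreover have "tensor_in (\<odot>) (\<Delta> x) (scalars H) (scalars H)" if x: "x \<in> scalars H" for x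
  proof -
    obtain c where c: "x = c \<odot> \<one>" using x by (auto simp: scalars_def)
    have "tensor_eq (\<odot>) (\<Delta> x) [(c \<odot> \<one>, \<one>)]"
      unfolding c by (rule tensor_eqI_functionals)
        (simp add: sw_scale sw_unit bilin_functional functional_scale closed)
    then show ?thesis unfolding tensor_in_def using x one c
      by (intro exI[of _ "[(c \<odot> \<one>, \<one>)]"]) simp
  qed
  moreover have "S x \<in> scalars H" if "x \<in> scalars H" for x
    using that by (auto simp: scalars_def antipode_scale antipode_unit closed)
  ultimately show ?thesis by (simp add: hopf_subalgebra_def)
qed

lemma scalars_central: "scalars H \<subseteq> center_of H V"
  by (auto simp: scalars_def center_of_iff mult_scale_left mult_scale_right unit_left unit_right closed)

text \<open>
  The subalgebra generated by all central Hopf subalgebras is again a central Hopf subalgebra, hence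
  the greatest one.  Its unit is contributed by the Hopf subalgebra of scalars.
\<close>

inductive_set central_hopf_closure :: "'a set" where
  base: "hopf_subalgebra H K \<Longrightarrow> K \<subseteq> center_of H V \<Longrightarrow> x \<in> K \<Longrightarrow> x \<in> central_hopf_closure"
| add: "x \<in> central_hopf_closure \<Longrightarrow> y \<in> central_hopf_closure \<Longrightarrow> x + y \<in> central_hopf_closure"
| scale: "x \<in> central_hopf_closure \<Longrightarrow> c \<odot> x \<in> central_hopf_closure"
| mult: "x \<in> central_hopf_closure \<Longrightarrow> y \<in> central_hopf_closure \<Longrightarrow> x \<cdot> y \<in> central_hopf_closure"

lemma central_hopf_closure_central: "x \<in> central_hopf_closure \<Longrightarrow> x \<in> center_of H V"
proof (induction rule: central_hopf_closure.induct)
  case (mult x y)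
  have "(x \<cdot> y) \<cdot> z = z \<cdot> (x \<cdot> y)" if "z \<in> V" for z
  proof -
    have m: "x \<in> V" "y \<in> V" "x \<cdot> z = z \<cdot> x" "y \<cdot> z = z \<cdot> y"
      using mult that by (auto simp: center_of_iff)
    have "(x \<cdot> y) \<cdot> z = x \<cdot> (z \<cdot> y)" using m that by (simp add: mult_assoc)
    also have "\<dots> = (z \<cdot> x) \<cdot> y" using m that by (simp add: mult_assoc[symmetric])
    also have "\<dots> = z \<cdot> (x \<cdot> y)" using m that by (simp add: mult_assoc)
    finally show ?thesis .
  qed
  moreover have "x \<cdot> y \<in> V" using mult by (blast dest: center_of_iff[THEN iffD1] intro: mult_closed)
  ultimately show ?case unfolding center_of_iff by blast
next
  case (base K x)
  then show ?case by blast
next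
  case (add x y)
  have "(x + y) \<cdot> z = z \<cdot> (x + y)" if "z \<in> V" for z
  proof -
    have "x \<in> V" "y \<in> V" "x \<cdot> z = z \<cdot> x" "y \<cdot> z = z \<cdot> y"
      using add that by (auto simp: center_of_iff)
    then show ?thesis using that by (simp add: mult_add_left mult_add_right)
  qed
  moreover have "x + y \<in> V" using add by (simp add: center_of_iff closed)
  ultimately show ?case unfolding center_of_iff by blast
next
  case (scale x c)
  have "(c \<odot> x) \<cdot> z = z \<cdot> (c \<odot> x)" if "z \<in> V" for z
  proof -
    have "x \<in> V" "x \<cdot> z = z \<cdot> x" using scale that by (auto simp: center_of_iff)
    then show ?thesis using that by (simp add: mult_scale_left mult_scale_right)
  qed
  moreover have "c \<odot> x \<in> V" using scale by (simp add: center_of_iff closed)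
  ultimately show ?case unfolding center_of_iff by blast
qed

lemma central_hopf_closure_hopf_subalgebra: "hopf_subalgebra H central_hopf_closure"
proof -
  let ?G = central_hopf_closure
  have scal: "scalars H \<subseteq> ?G"
    using scalars_hopf_subalgebra scalars_central base by blast
  have V: "?G \<subseteq> V" using central_hopf_closure_central by (auto simp: center_of_iff)
  have one: "\<one> \<in> ?G"
    using scal scalars_hopf_subalgebra by (auto simp: hopf_subalgebra_def unital_subalgebra_def)
  have zero: "0 \<in> ?G" using scale[OF one, of 0] by simp
  have sub: "subspace ?G" using zero by (intro subspaceI) (auto intro: add scale)
  have tens: "tensor_in (\<odot>) (\<Delta> x) ?G ?G \<and> S x \<in> ?G" if "x \<in> ?G" for x
    using that
  proof (induction rule: central_hopf_closure.induct)
    case (base K x)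
    then have "K \<subseteq> ?G" using central_hopf_closure.base by blast
    moreover have "tensor_in (\<odot>) (\<Delta> x) K K" "S x \<in> K"
      using base by (auto simp: hopf_subalgebra_def)
    ultimately have "tensor_in (\<odot>) (\<Delta> x) ?G ?G" unfolding tensor_in_def
      by (meson Sigma_mono order_trans)
    with \<open>K \<subseteq> ?G\<close> \<open>S x \<in> K\<close> show ?case by blast
  next
    case (add x y)
    then have xy: "x \<in> V" "y \<in> V" using V by auto
    obtain xs ys where xs: "set xs \<subseteq> ?G \<times> ?G" "tensor_eq (\<odot>) (\<Delta> x) xs"
      and ys: "set ys \<subseteq> ?G \<times> ?G" "tensor_eq (\<odot>) (\<Delta> y) ys"
      using add by (auto simp: tensor_in_def)
    have "tensor_eq (\<odot>) (\<Delta> (x + y)) (xs @ ys)"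
      using tensor_eq.trans[OF comult_add[OF xy] tensor_eq.append[OF xs(2) ys(2)]] .
    then show ?case using xs ys add xy
      by (auto simp: tensor_in_def antipode_add intro!: exI[of _ "xs @ ys"] central_hopf_closure.add)
  next
    case (scale x c)
    then have x: "x \<in> V" using V by auto
    obtain xs where xs: "set xs \<subseteq> ?G \<times> ?G" "\<And>B. bilin B \<Longrightarrow> sw x B = tensor_sum xs B"
      using tensor_inE[OF conjunct1[OF scale.IH] x V V] by metis
    have "tensor_eq (\<odot>) (\<Delta> (c \<odot> x)) (map (\<lambda>(a, b). (c \<odot> a, b)) xs)"
      by (rule tensor_eqI_functionals)
        (simp add: sw_scale x bilin_functional xs(2) tensor_sum_map functional_scale scale_tensor_sum)
    then show ?case using xs scale x
      by (auto simp: tensor_in_def antipode_scale intro!: exI[of _ "map (\<lambda>(a, b). (c \<odot> a, b)) xs"]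
          central_hopf_closure.scale)
  next
    case (mult x y)
    then have x: "x \<in> V" and y: "y \<in> V" using V by auto
    obtain xs where xs: "set xs \<subseteq> ?G \<times> ?G" "\<And>B. bilin B \<Longrightarrow> sw x B = tensor_sum xs B"
      using tensor_inE[OF conjunct1[OF mult.IH(1)] x V V] by metis
    obtain ys where ys: "set ys \<subseteq> ?G \<times> ?G" "\<And>B. bilin B \<Longrightarrow> sw y B = tensor_sum ys B"
      using tensor_inE[OF conjunct1[OF mult.IH(2)] y V V] by metis
    let ?zs = "[(a \<cdot> c, b \<cdot> d). (a, b) \<leftarrow> xs, (c, d) \<leftarrow> ys]"
    have "tensor_eq (\<odot>) (\<Delta> (x \<cdot> y)) ?zs"
    proof (rule tensor_eqI_functionals)
      fix f assume f: "functional f"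
      note lf = linear_on_functional[OF f]
      have "sw (x \<cdot> y) (\<lambda>a b. f a \<odot> b) = sw x (\<lambda>a b. sw y (\<lambda>c d. f (a \<cdot> c) \<odot> (b \<cdot> d)))"
        by (rule sw_mult[OF bilin_functional[OF f] x y])
      also have "\<dots> = tensor_sum xs (\<lambda>a b. sw y (\<lambda>c d. f (a \<cdot> c) \<odot> (b \<cdot> d)))"
        using y by (intro xs(2) lin_intros lf) (auto simp: closed)
      also have "\<dots> = tensor_sum xs (\<lambda>a b. tensor_sum ys (\<lambda>c d. f (a \<cdot> c) \<odot> (b \<cdot> d)))"
        using xs(1) V by (intro tensor_sum_cong ys(2) lin_intros lf) (auto simp: closed)
      finally show "sw (x \<cdot> y) (\<lambda>a b. f a \<odot> b) = tensor_sum ?zs (\<lambda>a b. f a \<odot> b)"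
        by (simp add: tensor_sum_product)
    qed
    moreover have "set ?zs \<subseteq> ?G \<times> ?G" using xs(1) ys(1) by (auto intro!: central_hopf_closure.mult)
    ultimately have "tensor_in (\<odot>) (\<Delta> (x \<cdot> y)) ?G ?G" unfolding tensor_in_def by blast
    then show ?case using mult.IH by (simp add: antipode_mult x y central_hopf_closure.mult)
  qed
  show ?thesis
    unfolding hopf_subalgebra_def unital_subalgebra_def using V sub one tens mult by auto
qed

lemma hopf_center_eq: "hopf_center H = central_hopf_closure"
  unfolding hopf_center_def
  using central_hopf_closure_hopf_subalgebra central_hopf_closure_central
  by (intro Greatest_equality) (auto intro: central_hopf_closure.base)

lemma hopf_center_hopf_subalgebra: "hopf_subalgebra H (hopf_center H)"
  and hopf_center_central: "hopf_center H \<subseteq> center_of H V"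
  using hopf_center_eq central_hopf_closure_hopf_subalgebra central_hopf_closure_central by auto

section \<open>Integrals of central subalgebras\<close>

lemma left_ideal_complement:
  assumes "hopf_semisimple H" "left_ideal H I"
  obtains J where "left_ideal H J" "I \<inter> J = {0}" "\<forall>x\<in>V. \<exists>u\<in>I. \<exists>v\<in>J. x = u + v"
proof -
  obtain J where J: "left_ideal H J" "I \<inter> J = {0}" and sum: "{x + y | x y. x \<in> I \<and> y \<in> J} = V"
    using assms(1)[unfolded hopf_semisimple_def, rule_format, OF assms(2)] by (elim exE conjE)
  have "\<forall>x\<in>V. \<exists>u\<in>I. \<exists>v\<in>J. x = u + v"
    unfolding sum[symmetric] by blast
  with J that show ?thesis by blast
qed

text \<open>
  A complement \<open>J\<close> of the left ideal \<open>ker \<epsilon>\<close> is a copy of the trivial module.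
\<close>

lemma left_integral_exists:
  assumes "hopf_semisimple H"
  obtains L where "L \<in> V" "\<epsilon> L = 1" "\<And>h. h \<in> V \<Longrightarrow> h \<cdot> L = \<epsilon> h \<odot> L"
proof -
  let ?I = "{x \<in> V. \<epsilon> x = 0}"
  have "left_ideal H ?I"
    unfolding left_ideal_def
    by (auto simp: closed counit_mult counit_zero counit_add counit_scale intro!: subspaceI)
  then obtain J where J: "left_ideal H J" "?I \<inter> J = {0}"
      "\<forall>x\<in>V. \<exists>u\<in>?I. \<exists>v\<in>J. x = u + v"
    by (rule left_ideal_complement[OF assms])
  then have sJ: "subspace J" "J \<subseteq> V" by (auto simp: left_ideal_def)
  obtain i j where ij: "\<one> = i + j" "i \<in> ?I" "j \<in> J" using bspec[OF J(3) unit_closed] by blast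
  have j: "j \<in> V" "\<epsilon> j = 1" using ij sJ counit_add[of i j] counit_unit by auto
  have "h \<cdot> j = \<epsilon> h \<odot> j" if h: "h \<in> V" for h
  proof -
    have "h \<cdot> j - \<epsilon> h \<odot> j \<in> J"
      using J(1) h ij(3) sJ by (intro subspace_diff subspace_scale) (auto simp: left_ideal_def)
    moreover have "h \<cdot> j - \<epsilon> h \<odot> j \<in> ?I"
      using h j by (simp add: closed counit_diff counit_mult counit_scale)
    ultimately have "h \<cdot> j - \<epsilon> h \<odot> j = 0" using J(2) by blast
    then show ?thesis by simp
  qed
  with j that show ?thesis by blast
qed

text \<open>
  For a left integral \<open>L\<close> every element is coinvariant, so \<open>H\<close> is spanned by the finitely many right
  factors of \<open>\<Delta>(L)\<close>.
\<close>

lemma finite_dimensional: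
  assumes "hopf_semisimple H"
  obtains E where "finite E" "V \<subseteq> span E"
proof -
  obtain L where L: "L \<in> V" "\<epsilon> L = 1" "\<And>h. h \<in> V \<Longrightarrow> h \<cdot> L = \<epsilon> h \<odot> L"
    using left_integral_exists[OF assms] by blast
  have coinv: "x \<in> coinvariants H L" if x: "x \<in> V" for x
  proof (rule coinvariantsI[OF x])
    fix f assume f: "functional f"
    have "sw x (\<lambda>a b. f a \<odot> (b \<cdot> L)) = sw x (\<lambda>a b. \<epsilon> b \<odot> (f a \<odot> L))"
      using x by (intro tensor_sum_cong) (auto simp: L closed mult.commute)
    also have "\<dots> = f x \<odot> L"
      using x by (intro sw_counit_right linear_on_functional[OF f] lin_intros) auto
    finally show "sw x (\<lambda>a b. f a \<odot> (b \<cdot> L)) = f x \<odot> L" .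
  qed
  let ?E = "snd ` set (\<Delta> L)"
  have EV: "span ?E \<subseteq> V"
    using comult_closed[OF L(1)] by (intro span_minimal carrier_subspace) auto
  have "tensor_in (\<odot>) (\<Delta> L) V (span ?E)"
    unfolding tensor_in_def using comult_closed[OF L(1)]
    by (intro exI[of _ "\<Delta> L"]) (force simp: tensor_eq.refl intro: span_base)
  then have "coinvariants H L \<subseteq> span ?E"
    using EV coinv by (intro coinvariants_in_support[OF L(1,2), of _ V]) (auto simp: closed)
  then show ?thesis using that[of ?E] coinv by auto
qed

text \<open>
  Write \<open>1 = qy + j\<close> according to a complement \<open>J\<close> of the left ideal \<open>Hy\<close>.  Centrality of \<open>y\<close> puts \<open>yj\<close>
  into \<open>Hy \<inter> J = 0\<close>, hence \<open>y = yqy\<close>.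
\<close>

lemma central_regular:
  assumes "hopf_semisimple H" "y \<in> center_of H V"
  obtains q where "q \<in> V" "y = q \<cdot> (y \<cdot> y)"
proof -
  have y: "y \<in> V" "\<And>x. x \<in> V \<Longrightarrow> y \<cdot> x = x \<cdot> y" using assms(2) by (auto simp: center_of_iff)
  let ?I = "{h \<cdot> y | h. h \<in> V}"
  have "subspace ?I"
  proof (rule subspaceI)
    show "0 \<in> ?I" using mult_zero(1)[OF y(1)] by (force simp: closed)
    show "u + v \<in> ?I" if "u \<in> ?I" "v \<in> ?I" for u v
      using that y(1) by (force simp: closed mult_add_left[symmetric])
    show "c \<odot> u \<in> ?I" if "u \<in> ?I" for c u
      using that y(1) by (force simp: closed mult_scale_left[symmetric])
  qed
  then have "left_ideal H ?I"
    unfolding left_ideal_def using y(1) by (force simp: closed mult_assoc[symmetric])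
  then obtain J where J: "left_ideal H J" "?I \<inter> J = {0}"
      "\<forall>x\<in>V. \<exists>u\<in>?I. \<exists>v\<in>J. x = u + v"
    by (rule left_ideal_complement[OF assms(1)])
  obtain q j where q: "\<one> = q \<cdot> y + j" "q \<in> V" "j \<in> J" using bspec[OF J(3) unit_closed] by blast
  have j: "j \<in> V" using J(1) q(3) by (auto simp: left_ideal_def)
  have "y \<cdot> j \<in> J" using J(1) q(3) y(1) by (auto simp: left_ideal_def)
  moreover have "y \<cdot> j \<in> ?I" using y(2)[OF j] j by auto
  ultimately have yj: "y \<cdot> j = 0" using J(2) by blast
  have "y = y \<cdot> (q \<cdot> y + j)" using q(1) y(1) by (metis unit_right)
  also have "\<dots> = y \<cdot> (q \<cdot> y)" using y j q by (simp add: mult_add_right yj closed)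
  also have "\<dots> = (q \<cdot> y) \<cdot> y" using y(1) q(2) by (intro y(2)) (simp add: closed)
  also have "\<dots> = q \<cdot> (y \<cdot> y)" using y(1) q(2) by (simp add: mult_assoc)
  finally show ?thesis using that q(2) by blast
qed

text \<open>
  The factor \<open>q\<close> of the previous lemma need not lie in \<open>K\<close>.  It shows, however, that multiplication by
  \<open>y\<close> is injective on the finite-dimensional space \<open>yK\<close>: if \<open>w = yk\<close> and \<open>yw = 0\<close>, then \<open>w\<^sup>2 = 0\<close> and so
  \<open>w = 0\<close>.  It is therefore onto, and \<open>y \<in> yK\<close> is of the form \<open>y(yg)\<close> with \<open>g \<in> K\<close>.
\<close>

lemma central_subalgebra_regular:
  assumes ss: "hopf_semisimple H" and K: "unital_subalgebra H K" "K \<subseteq> center_of H V"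
    and y: "y \<in> K"
  obtains g where "g \<in> K" "y = y \<cdot> (y \<cdot> g)"
proof -
  obtain E where E: "finite E" "V \<subseteq> span E" using finite_dimensional[OF ss] by blast
  note KD = unital_subalgebraD[OF K(1)]
  have comm: "k \<cdot> x = x \<cdot> k" if "k \<in> K" "x \<in> V" for k x
    using that K(2) by (auto simp: center_of_iff)
  obtain P where P: "Vector_Spaces.linear (\<odot>) (\<odot>) P" "\<And>x. x \<in> V \<Longrightarrow> P x = x" "\<And>x. P x \<in> V"
    using linear_projection_exists[OF carrier_subspace] by metis
  have yV: "y \<in> V" using y KD by auto
  let ?W = "(\<lambda>k. y \<cdot> k) ` K"
  let ?g = "\<lambda>v. y \<cdot> P v"
  have WK: "?W \<subseteq> K" using y KD by auto
  have lin_g: "Vector_Spaces.linear (\<odot>) (\<odot>) ?g"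
    unfolding Vector_Spaces.linear_iff using vector_space_axioms yV P(3)
    by (simp add: Vector_Spaces.linear.axioms mult_add_right mult_scale_right
        Vector_Spaces.linear_iff[THEN iffD1, OF P(1)])
  have subW: "subspace ?W"
  proof (rule subspaceI)
    show "0 \<in> ?W" using mult_zero(2)[OF yV] subspace_0[OF KD(2)] by (metis imageI)
    show "u + v \<in> ?W" if "u \<in> ?W" "v \<in> ?W" for u v
      using that KD(1) subspace_add[OF KD(2)] yV
      by (auto simp: subset_iff mult_add_right[symmetric])
    show "c \<odot> u \<in> ?W" if "u \<in> ?W" for c u
      using that KD(1) subspace_scale[OF KD(2)] yV
      by (auto simp: subset_iff mult_scale_right[symmetric])
  qed
  have "?g ` ?W = ?W"
  proof (rule injective_endomorphism_surjective[OF E(1) subW _ lin_g])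
    show "?W \<subseteq> span E" using WK KD(1) E(2) by blast
    show "?g ` ?W \<subseteq> ?W"
    proof
      fix v assume "v \<in> ?g ` ?W"
      then obtain w where w: "w \<in> ?W" "v = y \<cdot> P w" by blast
      then have "w \<in> K" "P w = w" using WK KD(1) P(2) by auto
      with w show "v \<in> ?W" by simp
    qed
    fix w assume w: "w \<in> ?W" "?g w = 0"
    then have wK: "w \<in> K" and wV: "w \<in> V" using WK KD(1) by blast+
    have yw: "y \<cdot> w = 0" using w(2) P(2)[OF wV] by simp
    obtain k where k: "k \<in> K" "w = y \<cdot> k" using w by blast
    obtain q where q: "q \<in> V" "w = q \<cdot> (w \<cdot> w)" using central_regular[OF ss, of w] wK K(2) by blast
    have "w \<cdot> w = (k \<cdot> y) \<cdot> w" using k comm[OF y, of k] KD(1) by auto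
    also have "\<dots> = 0" using k KD(1) yV wV yw by (simp add: mult_assoc subset_iff mult_zero)
    finally show "w = 0" using q mult_zero by metis
  qed
  moreover have "y \<in> ?W" using KD(3) unit_right[OF yV] by force
  ultimately have "y \<in> ?g ` ?W" by simp
  then obtain k where k: "k \<in> K" "y = ?g (y \<cdot> k)" by blast
  then have "P (y \<cdot> k) = y \<cdot> k" using WK KD(1) P(2) by blast
  with k that show ?thesis by metis
qed

text \<open>
  By regularity every \<open>y \<in> K\<^sup>+\<close> is killed by an element \<open>1 - yg\<close> of \<open>K\<close> with counit \<open>1\<close>.  The product of
  these elements over a finite basis of \<open>K\<^sup>+\<close> kills \<open>K\<^sup>+\<close>.
\<close>

lemma central_subalgebra_integral:
  assumes ss: "hopf_semisimple H" and K: "unital_subalgebra H K" "K \<subseteq> center_of H V"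
  obtains s where "s \<in> K" "\<epsilon> s = 1" "\<And>k. k \<in> K \<Longrightarrow> k \<cdot> s = \<epsilon> k \<odot> s"
proof -
  obtain E where E: "finite E" "V \<subseteq> span E" using finite_dimensional[OF ss] by blast
  note KD = unital_subalgebraD[OF K(1)]
  have KV: "\<And>k. k \<in> K \<Longrightarrow> k \<in> V" using KD(1) by auto
  have comm: "k \<cdot> x = x \<cdot> k" if "k \<in> K" "x \<in> V" for k x
    using that K(2) by (auto simp: center_of_iff)
  let ?M = "augmentation H K"
  obtain B where B: "B \<subseteq> ?M" "independent B" "?M \<subseteq> span B"
    using maximal_independent_subset by blast
  have "?M \<subseteq> span E" using KD(1) E(2) by (auto simp: augmentation_def)
  then have "finite B" using independent_span_bound[OF E(1) B(2)] B(1) by blast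
  then have "\<exists>s\<in>K. \<epsilon> s = 1 \<and> (\<forall>y\<in>B. y \<cdot> s = 0)" using B(1)
  proof (induction B rule: finite_induct)
    case empty
    then show ?case using KD(3) counit_unit by auto
  next
    case (insert y B)
    then obtain s where s: "s \<in> K" "\<epsilon> s = 1" "\<forall>y\<in>B. y \<cdot> s = 0" by auto
    have y: "y \<in> K" "\<epsilon> y = 0" using insert by (auto simp: augmentation_def)
    obtain g where g: "g \<in> K" "y = y \<cdot> (y \<cdot> g)" using central_subalgebra_regular[OF ss K y(1)] by blast
    let ?t = "\<one> - y \<cdot> g"
    have t: "?t \<in> K" using g(1) y(1) KD by (intro subspace_diff) auto
    have "\<epsilon> ?t = 1" using g(1) y KV by (simp add: counit_diff counit_mult counit_unit closed)
    moreover have "y \<cdot> ?t = 0" using g y KV by (simp add: mult_diff_right unit_right closed)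
    ultimately have "s \<cdot> ?t \<in> K" "\<epsilon> (s \<cdot> ?t) = 1" "y \<cdot> (s \<cdot> ?t) = 0"
      "\<forall>b\<in>B. b \<cdot> (s \<cdot> ?t) = 0"
    proof -
      assume et: "\<epsilon> ?t = 1" and yt: "y \<cdot> ?t = 0"
      show "s \<cdot> ?t \<in> K" using s t KD by auto
      show "\<epsilon> (s \<cdot> ?t) = 1" using et s t KV by (simp add: counit_mult)
      have "y \<cdot> (s \<cdot> ?t) = (s \<cdot> y) \<cdot> ?t" using s y t KV comm by (simp add: mult_assoc[symmetric])
      also have "\<dots> = 0" using yt s t y KV by (simp add: mult_assoc mult_zero)
      finally show "y \<cdot> (s \<cdot> ?t) = 0" .
      show "\<forall>b\<in>B. b \<cdot> (s \<cdot> ?t) = 0"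
      proof
        fix b assume b: "b \<in> B"
        then have "b \<in> K" using insert.prems by (auto simp: augmentation_def)
        then show "b \<cdot> (s \<cdot> ?t) = 0" using s b t KV by (simp add: mult_assoc[symmetric] mult_zero)
      qed
    qed
    then show ?case by blast
  qed
  then obtain s where s: "s \<in> K" "\<epsilon> s = 1" "\<forall>y\<in>B. y \<cdot> s = 0" by blast
  have sV: "s \<in> V" using s KV by auto
  have "subspace {y \<in> V. y \<cdot> s = 0}"
    using sV by (intro subspaceI) (auto simp: closed mult_zero mult_add_left mult_scale_left)
  then have ann: "y \<cdot> s = 0" if "y \<in> ?M" for y
    using that span_minimal[of B "{y \<in> V. y \<cdot> s = 0}"] s(3) B KV by (auto simp: augmentation_def subset_iff)
  have "k \<cdot> s = \<epsilon> k \<odot> s" if k: "k \<in> K" for k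
  proof -
    have "k - \<epsilon> k \<odot> \<one> \<in> ?M"
      using k KD KV[OF k] by (auto simp: augmentation_def counit_diff counit_scale counit_unit closed intro!: subspace_diff subspace_scale)
    then have "(k - \<epsilon> k \<odot> \<one>) \<cdot> s = 0" by (rule ann)
    then show ?thesis using KV[OF k] sV by (simp add: mult_diff_left mult_scale_left unit_left closed)
  qed
  with s that show ?thesis by blast
qed

end

section \<open>The quotient by a central Hopf subalgebra\<close>

locale central_hopf_integral = hopf_algebra H
  for H :: "('k::field, 'a::ab_group_add) hopf" (structure) +
  fixes K :: "'a set" and s :: 'a
  assumes K_hopf: "hopf_subalgebra H K" and K_central: "K \<subseteq> center_of H V"
    and s_K: "s \<in> K" and s_counit: "\<epsilon> s = 1" and s_integral: "\<And>k. k \<in> K \<Longrightarrow> k \<cdot> s = \<epsilon> k \<odot> s"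
begin

lemma K_unital: "unital_subalgebra H K"
  using K_hopf by (simp add: hopf_subalgebra_def)

lemmas KD = unital_subalgebraD[OF K_unital]

lemma K_V: "k \<in> K \<Longrightarrow> k \<in> V"
  using KD(1) by blast

lemma K_commutes: "k \<in> K \<Longrightarrow> x \<in> V \<Longrightarrow> k \<cdot> x = x \<cdot> k"
  using K_central by (auto simp: center_of_iff)

lemma s_V: "s \<in> V"
  using s_K K_V by blast

lemma s_idem: "s \<cdot> s = s"
  using s_integral[OF s_K] s_counit by simp

lemma K_antipode: "k \<in> K \<Longrightarrow> S k \<in> K"
  using K_hopf by (simp add: hopf_subalgebra_def)

lemma K_tensor:
  assumes "k \<in> K"
  obtains ys where "set ys \<subseteq> K \<times> K" "\<And>B. bilin B \<Longrightarrow> sw k B = tensor_sum ys B"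
proof -
  have "tensor_in (\<odot>) (\<Delta> k) K K" using K_hopf assms by (simp add: hopf_subalgebra_def)
  then show ?thesis using tensor_inE[OF _ K_V[OF assms] KD(1) KD(1)] that by metis
qed

lemma K_coinvariant: "K \<subseteq> coinvariants H s"
proof
  fix k assume k: "k \<in> K"
  obtain ys where ys: "set ys \<subseteq> K \<times> K" "\<And>B. bilin B \<Longrightarrow> sw k B = tensor_sum ys B"
    using K_tensor[OF k] by blast
  show "k \<in> coinvariants H s"
  proof (rule coinvariantsI[OF K_V[OF k]])
    fix f assume f: "functional f"
    note lf = linear_on_functional[OF f]
    have "sw k (\<lambda>a b. f a \<odot> (b \<cdot> s)) = tensor_sum ys (\<lambda>a b. f a \<odot> (b \<cdot> s))"
      by (intro ys(2) lin_intros lf) (auto simp: closed s_V)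
    also have "\<dots> = tensor_sum ys (\<lambda>a b. \<epsilon> b \<odot> (f a \<odot> s))"
      using ys(1) by (intro tensor_sum_cong) (auto simp: s_integral mult.commute)
    also have "\<dots> = sw k (\<lambda>a b. \<epsilon> b \<odot> (f a \<odot> s))"
      by (intro ys(2)[symmetric] lin_intros lf) auto
    also have "\<dots> = f k \<odot> s"
      using K_V[OF k] by (intro sw_counit_right lf lin_intros)
    finally show "sw k (\<lambda>a b. f a \<odot> (b \<cdot> s)) = f k \<odot> s" .
  qed
qed

text \<open>
  The tensor \<open>\<Delta>(s)\<close> lies in \<open>K \<otimes> K\<close>, and antipodes of elements of \<open>K\<close> are coinvariant.
\<close>

lemma coinvariants_eq: "coinvariants H s = K"
proof
  have "tensor_in (\<odot>) (\<Delta> s) K K" using K_hopf s_K by (simp add: hopf_subalgebra_def)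
  then show "coinvariants H s \<subseteq> K"
    using K_coinvariant K_antipode
    by (intro coinvariants_in_support[OF s_V s_counit KD(2,1) KD(1)]) auto
qed (rule K_coinvariant)

text \<open>
  The inclusion from right to left is \<open>x = x(1 - s)\<close> with \<open>1 - s \<in> K\<^sup>+\<close>.
\<close>

lemma augmentation_ideal_eq: "augmentation_ideal H K = {x \<in> V. x \<cdot> s = 0}"
proof
  have sub: "subspace {x \<in> V. x \<cdot> s = 0}"
    using s_V by (intro subspaceI) (auto simp: closed mult_zero mult_add_left mult_scale_left)
  have "h \<cdot> n \<in> {x \<in> V. x \<cdot> s = 0}" if "h \<in> V" "n \<in> augmentation H K" for h n
    using that s_V K_V by (auto simp: augmentation_def closed mult_assoc s_integral mult_zero)
  then show "augmentation_ideal H K \<subseteq> {x \<in> V. x \<cdot> s = 0}"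
    unfolding augmentation_ideal_def by (intro span_minimal sub) blast
  show "{x \<in> V. x \<cdot> s = 0} \<subseteq> augmentation_ideal H K"
  proof safe
    fix x assume x: "x \<in> V" "x \<cdot> s = 0"
    have "\<one> - s \<in> augmentation H K"
      using KD s_K s_V by (auto simp: augmentation_def counit_diff counit_unit s_counit closed intro: subspace_diff)
    moreover have "x = x \<cdot> (\<one> - s)" using x s_V by (simp add: mult_diff_right unit_right closed)
    ultimately show "x \<in> augmentation_ideal H K"
      unfolding augmentation_ideal_def using x(1) by (intro span_base) blast
  qed
qed

definition p :: "'a \<Rightarrow> 'a" where "p = quotient_proj H K"
definition Q :: "('k, 'a) hopf" where "Q = hopf_quotient H K"

lemma p_props: "Vector_Spaces.linear (\<odot>) (\<odot>) p \<and> p ` V \<subseteq> V \<and> (\<forall>x\<in>V. p (p x) = p x) \<and>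
     {x \<in> V. p x = 0} = augmentation_ideal H K"
proof -
  have "subspace (augmentation_ideal H K)" unfolding augmentation_ideal_def by (rule subspace_span)
  moreover have "augmentation_ideal H K \<subseteq> V" using augmentation_ideal_eq by blast
  ultimately obtain q where "Vector_Spaces.linear (\<odot>) (\<odot>) q" "q ` V \<subseteq> V" "\<forall>x\<in>V. q (q x) = q x"
    "{x \<in> V. q x = 0} = augmentation_ideal H K"
    by (rule projection_with_kernel[OF _ carrier_subspace])
  then have "\<exists>q. Vector_Spaces.linear (\<odot>) (\<odot>) q \<and> q ` V \<subseteq> V \<and> (\<forall>x\<in>V. q (q x) = q x) \<and>
     {x \<in> V. q x = 0} = augmentation_ideal H K" by (intro exI[of _ q] conjI)
  from someI_ex[OF this] show ?thesis unfolding p_def quotient_proj_def .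
qed

lemma p_linear: "Vector_Spaces.linear (\<odot>) (\<odot>) p"
  and p_V: "x \<in> V \<Longrightarrow> p x \<in> V"
  and p_idem: "x \<in> V \<Longrightarrow> p (p x) = p x"
  using p_props by auto

lemma p_add: "p (x + y) = p x + p y"
  and p_scale: "p (c \<odot> x) = c \<odot> p x"
  and p_diff: "p (x - y) = p x - p y"
  and p_zero: "p 0 = 0"
proof -
  interpret vector_space_pair "(\<odot>)" "(\<odot>)" by unfold_locales
  show "p (x + y) = p x + p y" "p (c \<odot> x) = c \<odot> p x" "p (x - y) = p x - p y" "p 0 = 0"
    using p_linear by (simp_all add: linear_add linear_scale linear_diff linear_0)
qed

lemma p_eq_0_iff: "x \<in> V \<Longrightarrow> p x = 0 \<longleftrightarrow> x \<cdot> s = 0"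
  using p_props augmentation_ideal_eq by blast

lemma p_eq_iff: "x \<in> V \<Longrightarrow> y \<in> V \<Longrightarrow> p x = p y \<longleftrightarrow> x \<cdot> s = y \<cdot> s"
  using p_eq_0_iff[of "x - y"] by (simp add: p_diff mult_diff_left s_V closed)

lemma p_mult_s: "x \<in> V \<Longrightarrow> p (x \<cdot> s) = p x"
  using s_V by (subst p_eq_iff) (simp_all add: closed mult_assoc s_idem)

lemma p_s: "x \<in> V \<Longrightarrow> p x \<cdot> s = x \<cdot> s"
  using p_eq_iff[of "p x" x] by (simp add: p_V p_idem)

lemma mult_s_swap: "x \<in> V \<Longrightarrow> y \<in> V \<Longrightarrow> (x \<cdot> y) \<cdot> s = (x \<cdot> s) \<cdot> y"
  using K_commutes[OF s_K, of y] by (simp add: mult_assoc s_V)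

lemma p_mult_left: "x \<in> V \<Longrightarrow> y \<in> V \<Longrightarrow> p (p x \<cdot> y) = p (x \<cdot> y)"
proof (subst p_eq_iff)
  assume m: "x \<in> V" "y \<in> V"
  then show "p x \<cdot> y \<in> V" "x \<cdot> y \<in> V" by (simp_all add: closed p_V)
  have "(p x \<cdot> y) \<cdot> s = (p x \<cdot> s) \<cdot> y"
    using m by (intro mult_s_swap p_V)
  also have "\<dots> = (x \<cdot> s) \<cdot> y" using m by (simp add: p_s)
  also have "\<dots> = (x \<cdot> y) \<cdot> s"
    using m by (simp add: mult_s_swap)
  finally show "(p x \<cdot> y) \<cdot> s = (x \<cdot> y) \<cdot> s" .
qed

lemma p_mult_right: "x \<in> V \<Longrightarrow> y \<in> V \<Longrightarrow> p (x \<cdot> p y) = p (x \<cdot> y)"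
  by (subst p_eq_iff) (simp_all add: closed p_V p_s mult_assoc s_V)

lemma counit_p: "x \<in> V \<Longrightarrow> \<epsilon> (p x) = \<epsilon> x"
proof -
  assume x: "x \<in> V"
  have "\<epsilon> (p x) = \<epsilon> (p x \<cdot> s)" using x by (simp add: counit_mult p_V s_V s_counit)
  also have "\<dots> = \<epsilon> x" using x by (simp add: p_s counit_mult s_V s_counit)
  finally show ?thesis .
qed

lemma lin_p: "lin g \<Longrightarrow> lin (\<lambda>x. p (g x))"
  by (rule linear_on_comp[OF p_linear])

text \<open>
  Since \<open>S(s) \<in> K\<close> and \<open>\<epsilon>(S(s)) = 1\<close>, one has \<open>S(s)s = s\<close>; hence \<open>S(y)s\<close> depends on \<open>ys\<close> only.
\<close>

lemma p_antipode: "x \<in> V \<Longrightarrow> p (S (p x)) = p (S x)"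
proof (subst p_eq_iff)
  assume x: "x \<in> V"
  then show "S (p x) \<in> V" "S x \<in> V" by (simp_all add: closed p_V)
  have ss: "S s \<in> K" using s_K by (rule K_antipode)
  have Ss: "S s \<cdot> s = s" using ss by (simp add: s_integral counit_antipode s_V s_counit)
  have *: "S y \<cdot> s = S (y \<cdot> s) \<cdot> s" if y: "y \<in> V" for y
  proof -
    have "S (y \<cdot> s) \<cdot> s = (S s \<cdot> S y) \<cdot> s" using y by (simp add: antipode_mult s_V)
    also have "\<dots> = (S y \<cdot> S s) \<cdot> s" using y by (simp add: K_commutes[OF ss] closed)
    also have "\<dots> = S y \<cdot> s" using y by (simp add: mult_assoc closed s_V Ss)
    finally show ?thesis by simp
  qed
  show "S (p x) \<cdot> s = S x \<cdot> s" using x *[of x] *[of "p x"] by (simp add: p_V p_s)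
qed

lemma sw_s: "bilin B \<Longrightarrow> sw s (\<lambda>a b. B a (b \<cdot> s)) = B s s"
  using coinvariants_sum[OF _ s_V] K_coinvariant s_K by blast

text \<open>
  Both sides equal the sum over \<open>\<Delta>(xs) = \<Delta>(x)\<Delta>(s)\<close>: the factor \<open>\<Delta>(s)\<close> may be multiplied by \<open>1 \<otimes> s\<close>
  under the projection, which turns it into \<open>s \<otimes> s\<close>, and this factor is invisible to \<open>p \<otimes> p\<close>.
\<close>

lemma sw_p:
  assumes x: "x \<in> V" and B: "bilin B"
  shows "sw (p x) (\<lambda>a b. B (p a) (p b)) = sw x (\<lambda>a b. B (p a) (p b))"
proof -
  have Bp: "bilin (\<lambda>a b. B (p (u \<cdot> a)) (p (v \<cdot> b)))" if "u \<in> V" "v \<in> V" for u v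
    using B that by (auto simp: bilinear_on_def linear_on_def p_add p_scale mult_add_right
        mult_scale_right closed p_V)
  have Bp1: "bilin (\<lambda>a b. B (p a) (p b))"
    using B by (auto simp: bilinear_on_def linear_on_def p_add p_scale p_V)
  have *: "sw (y \<cdot> s) (\<lambda>a b. B (p a) (p b)) = sw y (\<lambda>a b. B (p a) (p b))" if y: "y \<in> V" for y
  proof -
    have "sw (y \<cdot> s) (\<lambda>a b. B (p a) (p b)) = sw y (\<lambda>a b. sw s (\<lambda>c d. B (p (a \<cdot> c)) (p (b \<cdot> d))))"
      by (rule sw_mult[OF Bp1 y s_V])
    also have "\<dots> = sw y (\<lambda>a b. sw s (\<lambda>c d. B (p (a \<cdot> c)) (p (b \<cdot> (d \<cdot> s)))))"
      using y by (intro tensor_sum_cong) (simp add: closed mult_assoc[symmetric] p_mult_s s_V)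
    also have "\<dots> = sw y (\<lambda>a b. B (p (a \<cdot> s)) (p (b \<cdot> s)))"
      using y by (intro tensor_sum_cong sw_s Bp) (auto simp: closed)
    also have "\<dots> = sw y (\<lambda>a b. B (p a) (p b))"
      using y by (intro tensor_sum_cong) (simp add: closed p_mult_s)
    finally show ?thesis .
  qed
  show ?thesis using *[OF x] *[OF p_V[OF x]] by (simp add: p_s x)
qed

abbreviation pp :: "('a \<times> 'a) list \<Rightarrow> ('a \<times> 'a) list" where
  "pp \<equiv> map (\<lambda>(a, b). (p a, p b))"

lemma comult_p: "x \<in> V \<Longrightarrow> tensor_eq (\<odot>) (pp (\<Delta> (p x))) (pp (\<Delta> x))"
  by (rule tensor_eqI_functionals) (simp add: tensor_sum_map sw_p[OF _ bilin_functional])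

lemma Q_simps:
  "hcarrier Q = p ` V" "hscale Q = (\<odot>)" "hmult Q = (\<lambda>x y. p (x \<cdot> y))" "hunit Q = p \<one>"
  "hcomult Q = (\<lambda>x. pp (\<Delta> x))" "hcounit Q = \<epsilon>" "hantipode Q = (\<lambda>x. p (S x))"
  by (simp_all add: Q_def hopf_quotient_def p_def Let_def)

lemma Q_carrierD: "x \<in> hcarrier Q \<Longrightarrow> x \<in> V \<and> p x = x"
  by (auto simp: Q_simps p_V p_idem)

lemma Q_subspace: "subspace (p ` V)"
  using module_hom.subspace_image[OF p_linear[unfolded module_hom_iff_linear[symmetric]] carrier_subspace] .

lemma Q_hopf: "hopf_algebra Q"
proof (unfold hopf_algebra_def bialgebra_def unital_algebra_def coalgebra_def, intro conjI)
  show vs: "vector_space (hscale Q)" "vector_space (hscale Q)"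
    by (simp_all add: Q_simps vector_space_axioms)
  note D = Q_carrierD
  show "unital_algebra_axioms Q"
  proof (unfold_locales, goal_cases)
    case 1 then show ?case using Q_subspace by (simp add: Q_simps)
  next case (2 x y) then show ?case using D[of x] D[of y] by (simp add: Q_simps closed)
  next case 3 then show ?case by (simp add: Q_simps closed)
  next case (4 x y z)
    then have "x \<in> V" "y \<in> V" "z \<in> V" using D by auto
    then show ?case by (simp add: Q_simps closed p_mult_left p_mult_right mult_assoc)
  next case (5 x) then show ?case using D[of x] by (simp add: Q_simps p_mult_left unit_left closed)
  next case (6 x) then show ?case using D[of x] by (simp add: Q_simps p_mult_right unit_right closed)
  next case (7 x y z)
    then have "x \<in> V" "y \<in> V" "z \<in> V" using D by auto
    then show ?case by (simp add: Q_simps mult_add_left p_add)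
  next case (8 x y z)
    then have "x \<in> V" "y \<in> V" "z \<in> V" using D by auto
    then show ?case by (simp add: Q_simps mult_add_right p_add)
  next case (9 x y c) then show ?case using D[of x] D[of y] by (simp add: Q_simps mult_scale_left p_scale)
  next case (10 x y c) then show ?case using D[of x] D[of y] by (simp add: Q_simps mult_scale_right p_scale)
  qed
  show "coalgebra_axioms Q"
  proof (unfold_locales, goal_cases)
    case 1 then show ?case using Q_subspace by (simp add: Q_simps)
  next case (2 x) then show ?case using D[of x] comult_closed[of x] by (auto simp: Q_simps)
  next case (3 x y)
    then show ?case using D[of x] D[of y] tensor_eq_map[OF p_linear comult_add[of x y]] by (simp add: Q_simps)
  next case (4 x c)
    then have x: "x \<in> V" using D by auto
    have "map (\<lambda>(a, b). (c \<odot> a, b)) (pp (\<Delta> x)) = pp (map (\<lambda>(a, b). (c \<odot> a, b)) (\<Delta> x))"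
      by (simp add: p_scale case_prod_unfold)
    then show ?case using tensor_eq_map[OF p_linear comult_scale[OF x, of c]] by (simp only: Q_simps)
  next case (5 x)
    then have x: "x \<in> V" using D by auto
    let ?ppp = "map (\<lambda>(a, b, d). (p a, p b, p d))"
    \<comment> \<open>In the quotient the inner coproduct is taken at \<open>p u\<close> instead of \<open>u\<close>; up to tensor equality
      \<open>comult_p\<close> removes the difference, and then both sides are images of those in \<open>H\<close>.\<close>
    have L: "tensor3_eq (\<odot>) [(a, b, d). (u, d) \<leftarrow> pp (\<Delta> x), (a, b) \<leftarrow> pp (\<Delta> u)]
        (?ppp [(a, b, d). (u, d) \<leftarrow> \<Delta> x, (a, b) \<leftarrow> \<Delta> u])"
    proof -
      have "tensor3_eq (\<odot>) (concat (map (\<lambda>(u, d). map (\<lambda>(a, b). (a, b, p d)) (pp (\<Delta> (p u)))) (\<Delta> x)))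
         (concat (map (\<lambda>(u, d). map (\<lambda>(a, b). (a, b, p d)) (pp (\<Delta> u))) (\<Delta> x)))"
        using x by (intro tensor3_eq_concat) (auto simp: closed simp del: map_map intro!: tensor3_eq_tensor_left comult_p)
      then show ?thesis by (simp add: map_concat o_def case_prod_unfold)
    qed
    have R: "tensor3_eq (\<odot>) [(a, b, d). (a, v) \<leftarrow> pp (\<Delta> x), (b, d) \<leftarrow> pp (\<Delta> v)]
        (?ppp [(a, b, d). (a, v) \<leftarrow> \<Delta> x, (b, d) \<leftarrow> \<Delta> v])"
    proof -
      have "tensor3_eq (\<odot>) (concat (map (\<lambda>(a, v). map (\<lambda>(b, d). (p a, b, d)) (pp (\<Delta> (p v)))) (\<Delta> x)))
         (concat (map (\<lambda>(a, v). map (\<lambda>(b, d). (p a, b, d)) (pp (\<Delta> v))) (\<Delta> x)))"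
        using x by (intro tensor3_eq_concat) (auto simp: closed simp del: map_map intro!: tensor3_eq_tensor_right[simplified] comult_p)
      then show ?thesis by (simp add: map_concat o_def case_prod_unfold)
    qed
    show ?case unfolding Q_simps
      using tensor3_eq.trans[OF L tensor3_eq.trans[OF tensor3_eq_map[OF p_linear coassoc[OF x]] tensor3_eq.sym[OF R]]] .
  next case (6 x y) then show ?case using D[of x] D[of y] by (simp add: Q_simps counit_add)
  next case (7 x c) then show ?case using D[of x] by (simp add: Q_simps counit_scale)
  next case (8 x)
    then have x: "x \<in> V" "p x = x" using D by auto
    have "tensor_sum (pp (\<Delta> x)) (\<lambda>a b. \<epsilon> a \<odot> b) = sw x (\<lambda>a b. \<epsilon> a \<odot> p b)"
      unfolding tensor_sum_map using x by (intro tensor_sum_cong) (simp add: counit_p closed)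
    also have "\<dots> = p x" using x(1) by (intro sw_counit_left lin_p lin_intros)
    finally show ?case using x by (simp add: Q_simps tensor_sum_def)
  next case (9 x)
    then have x: "x \<in> V" "p x = x" using D by auto
    have "tensor_sum (pp (\<Delta> x)) (\<lambda>a b. \<epsilon> b \<odot> a) = sw x (\<lambda>a b. \<epsilon> b \<odot> p a)"
      unfolding tensor_sum_map using x by (intro tensor_sum_cong) (simp add: counit_p closed)
    also have "\<dots> = p x" using x(1) by (intro sw_counit_right lin_p lin_intros)
    finally show ?case using x by (simp add: Q_simps tensor_sum_def)
  qed
  show "bialgebra_axioms Q"
  proof (unfold_locales, goal_cases)
    case (1 x y)
    then have x: "x \<in> V" and y: "y \<in> V" using D by auto
    let ?zs = "[(a \<cdot> c, b \<cdot> d). (a, b) \<leftarrow> \<Delta> x, (c, d) \<leftarrow> \<Delta> y]"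
    have "tensor_eq (\<odot>) (pp (\<Delta> (p (x \<cdot> y)))) (pp ?zs)"
      using tensor_eq.trans[OF comult_p tensor_eq_map[OF p_linear comult_mult[OF x y]]] x y by (simp add: closed)
    moreover have "pp ?zs = [(p (a \<cdot> c), p (b \<cdot> d)). (a, b) \<leftarrow> pp (\<Delta> x), (c, d) \<leftarrow> pp (\<Delta> y)]"
      using x y by (auto simp: map_concat o_def case_prod_unfold p_mult_left p_mult_right p_V closed
          intro!: arg_cong[where f = concat])
    ultimately show ?case by (simp add: Q_simps)
  next case 2
    then show ?case using tensor_eq.trans[OF comult_p[OF unit_closed] tensor_eq_map[OF p_linear comult_unit]]
      by (simp add: Q_simps)
  next case (3 x y) then show ?case using D[of x] D[of y] by (simp add: Q_simps counit_p counit_mult closed)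
  next case 4 then show ?case by (simp add: Q_simps counit_p counit_unit closed)
  qed
  show "hopf_algebra_axioms Q"
  proof (unfold_locales, goal_cases)
    case (1 x) then show ?case using D[of x] by (simp add: Q_simps closed)
  next case (2 x y) then show ?case using D[of x] D[of y] by (simp add: Q_simps antipode_add p_add)
  next case (3 x c) then show ?case using D[of x] by (simp add: Q_simps antipode_scale p_scale)
  next case (4 x)
    then have x: "x \<in> V" "p x = x" using D by auto
    have "tensor_sum (pp (\<Delta> x)) (\<lambda>a b. p (p (S a) \<cdot> b)) = sw x (\<lambda>a b. p (S a \<cdot> b))"
      unfolding tensor_sum_map using x
      by (intro tensor_sum_cong) (simp add: p_antipode p_mult_left p_mult_right p_V closed)
    also have "\<dots> = \<epsilon> x \<odot> p \<one>" using x(1) by (intro sw_antipode_left lin_p lin_intros)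
    finally show ?case by (simp add: Q_simps tensor_sum_def)
  next case (5 x)
    then have x: "x \<in> V" "p x = x" using D by auto
    have "tensor_sum (pp (\<Delta> x)) (\<lambda>a b. p (a \<cdot> p (S b))) = sw x (\<lambda>a b. p (a \<cdot> S b))"
      unfolding tensor_sum_map using x
      by (intro tensor_sum_cong) (simp add: p_antipode p_mult_left p_mult_right p_V closed)
    also have "\<dots> = \<epsilon> x \<odot> p \<one>" using x(1) by (intro sw_antipode_right lin_p lin_intros)
    finally show ?case by (simp add: Q_simps tensor_sum_def)
  qed
qed

text \<open>
  Complements are found upstairs: if \<open>J\<close> is a complement of the preimage of \<open>I\<close>, then the image of \<open>J\<close>
  is a complement of \<open>I\<close>.
\<close>

lemma Q_semisimple:
  assumes ss: "hopf_semisimple H"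
  shows "hopf_semisimple Q"
  unfolding hopf_semisimple_def
proof (intro allI impI)
  fix I assume I: "left_ideal Q I"
  then have I_p: "I \<subseteq> p ` V" and I_sub: "subspace I"
    and I_mult: "\<And>h x. h \<in> V \<Longrightarrow> x \<in> I \<Longrightarrow> p (p h \<cdot> x) \<in> I"
    by (auto simp: left_ideal_def Q_simps)
  let ?I = "{x \<in> V. p x \<in> I}"
  have "subspace ?I"
    using I_sub by (intro subspaceI)
      (auto simp: closed p_add p_scale p_zero subspace_0 subspace_add subspace_scale)
  moreover have "h \<cdot> x \<in> ?I" if "h \<in> V" "x \<in> ?I" for h x
    using that I_mult[of h "p x"] by (simp add: closed p_mult_left p_mult_right p_V)
  ultimately have "left_ideal H ?I" by (auto simp: left_ideal_def)
  then obtain J where J: "left_ideal H J" "?I \<inter> J = {0}" "\<forall>x\<in>V. \<exists>u\<in>?I. \<exists>v\<in>J. x = u + v"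
    by (rule left_ideal_complement[OF ss])
  have JD: "J \<subseteq> V" "subspace J" "\<And>h x. h \<in> V \<Longrightarrow> x \<in> J \<Longrightarrow> h \<cdot> x \<in> J"
    using J(1) by (auto simp: left_ideal_def)
  have subJ: "subspace (p ` J)"
    using module_hom.subspace_image[OF p_linear[unfolded module_hom_iff_linear[symmetric]] JD(2)] .
  have pJ_V: "p ` J \<subseteq> p ` V" using JD(1) by blast
  have "p (h \<cdot> x) \<in> p ` J" if "h \<in> p ` V" "x \<in> p ` J" for h x
  proof -
    obtain h' j where "h' \<in> V" "h = p h'" "j \<in> J" "x = p j" using \<open>h \<in> p ` V\<close> \<open>x \<in> p ` J\<close> by auto
    moreover have "j \<in> V" using \<open>j \<in> J\<close> JD(1) by blast
    ultimately have "p (h \<cdot> x) = p (h' \<cdot> j)" by (simp add: p_mult_left p_mult_right p_V)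
    then show ?thesis using JD(3)[OF \<open>h' \<in> V\<close> \<open>j \<in> J\<close>] by blast
  qed
  then have "left_ideal Q (p ` J)"
    unfolding left_ideal_def Q_simps using subJ pJ_V by blast
  moreover have "I \<inter> p ` J = {0}"
  proof
    show "I \<inter> p ` J \<subseteq> {0}"
    proof safe
      fix j assume "p j \<in> I" "j \<in> J"
      then have "j \<in> ?I \<inter> J" using JD(1) by blast
      then show "p j = 0" using J(2) p_zero by auto
    qed
    show "{0} \<subseteq> I \<inter> p ` J" using subspace_0[OF I_sub] subspace_0[OF subJ] by simp
  qed
  moreover have "{x + y | x y. x \<in> I \<and> y \<in> p ` J} = p ` V"
  proof
    show "{x + y | x y. x \<in> I \<and> y \<in> p ` J} \<subseteq> p ` V"
      using I_p pJ_V Q_subspace by (auto intro!: subspace_add)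
    show "p ` V \<subseteq> {x + y | x y. x \<in> I \<and> y \<in> p ` J}"
    proof
      fix z assume "z \<in> p ` V"
      then obtain x where x: "x \<in> V" "z = p x" by blast
      then obtain u v where "u \<in> ?I" "v \<in> J" "x = u + v" using bspec[OF J(3) x(1)] by blast
      then show "z \<in> {x + y | x y. x \<in> I \<and> y \<in> p ` J}" using x(2) p_add by blast
    qed
  qed
  ultimately show "\<exists>J. left_ideal Q J \<and> I \<inter> J = {0} \<and> {x + y | x y. x \<in> I \<and> y \<in> J} = hcarrier Q"
    unfolding Q_simps(1) by blast
qed

end

section \<open>Coinvariants as left coideal subalgebras\<close>

context hopf_algebra
begin

lemma coinvariants_unital_subalgebra:
  assumes z: "z \<in> V"
  shows "unital_subalgebra H (coinvariants H z)"
proof -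
  have sub: "subspace (coinvariants H z)"
  proof (rule subspaceI)
    have s0: "sw 0 B = 0" if "bilin B" for B
      using sw_scale[OF that unit_closed, of 0] by simp
    have Bz: "bilin (\<lambda>a b. f a \<odot> (b \<cdot> z))" if "functional f" for f
      using z by (intro lin_intros linear_on_functional[OF that]) auto
    show "0 \<in> coinvariants H z"
      by (rule coinvariantsI) (simp_all add: closed s0 Bz functional_zero)
    show "x + y \<in> coinvariants H z" if "x \<in> coinvariants H z" "y \<in> coinvariants H z" for x y
    proof (rule coinvariantsI)
      have xy: "x \<in> V" "y \<in> V" using that coinvariants_subset by auto
      then show "x + y \<in> V" by (simp add: closed)
      show "sw (x + y) (\<lambda>a b. f a \<odot> (b \<cdot> z)) = f (x + y) \<odot> z" if f: "functional f" for f
        using coinvariants_sum[OF \<open>x \<in> coinvariants H z\<close> z bilin_functional[OF f]]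
          coinvariants_sum[OF \<open>y \<in> coinvariants H z\<close> z bilin_functional[OF f]]
        by (simp add: sw_add[OF Bz[OF f] xy] functional_add[OF f] scale_left_distrib)
    qed
    show "c \<odot> x \<in> coinvariants H z" if "x \<in> coinvariants H z" for c x
    proof (rule coinvariantsI)
      have x: "x \<in> V" using that coinvariants_subset by auto
      then show "c \<odot> x \<in> V" by (simp add: closed)
      show "sw (c \<odot> x) (\<lambda>a b. f a \<odot> (b \<cdot> z)) = f (c \<odot> x) \<odot> z" if f: "functional f" for f
        using coinvariants_sum[OF \<open>x \<in> coinvariants H z\<close> z bilin_functional[OF f]]
        by (simp add: sw_scale[OF Bz[OF f] x] functional_scale[OF f])
    qed
  qed
  have one: "\<one> \<in> coinvariants H z"
  proof (rule coinvariantsI[OF unit_closed])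
    fix f assume f: "functional f"
    have "sw \<one> (\<lambda>a b. f a \<odot> (b \<cdot> z)) = f \<one> \<odot> (\<one> \<cdot> z)"
      using z by (intro sw_unit lin_intros linear_on_functional[OF f]) auto
    then show "sw \<one> (\<lambda>a b. f a \<odot> (b \<cdot> z)) = f \<one> \<odot> z" using z by (simp add: unit_left)
  qed
  have mult: "x \<cdot> y \<in> coinvariants H z" if cx: "x \<in> coinvariants H z" and cy: "y \<in> coinvariants H z" for x y
  proof (rule coinvariantsI)
    have x: "x \<in> V" and y: "y \<in> V" using that coinvariants_subset by auto
    then show "x \<cdot> y \<in> V" by (simp add: closed)
    fix f assume f: "functional f"
    note lf = linear_on_functional[OF f]
    have "sw (x \<cdot> y) (\<lambda>a b. f a \<odot> (b \<cdot> z)) = sw x (\<lambda>a b. sw y (\<lambda>c d. f (a \<cdot> c) \<odot> ((b \<cdot> d) \<cdot> z)))"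
      using x y z by (intro sw_mult[where B = "\<lambda>a b. f a \<odot> (b \<cdot> z)"] lin_intros lf) (auto simp: closed)
    also have "\<dots> = sw x (\<lambda>a b. sw y (\<lambda>c d. f (a \<cdot> c) \<odot> (b \<cdot> (d \<cdot> z))))"
      using x y z by (intro tensor_sum_cong) (simp add: mult_assoc closed)
    also have "\<dots> = sw x (\<lambda>a b. f (a \<cdot> y) \<odot> (b \<cdot> z))"
      using x y z
      by (intro tensor_sum_cong coinvariants_sum[OF cy z, where B = "\<lambda>c d. f (_ \<cdot> c) \<odot> (_ \<cdot> d)"] lin_intros lf)
        (auto simp: closed)
    also have "\<dots> = f (x \<cdot> y) \<odot> z"
      using x y z by (intro coinvariants_sum[OF cx z, where B = "\<lambda>u v. f (u \<cdot> y) \<odot> v"] lin_intros lf)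
        (auto simp: closed)
    finally show "sw (x \<cdot> y) (\<lambda>a b. f a \<odot> (b \<cdot> z)) = f (x \<cdot> y) \<odot> z" .
  qed
  show ?thesis
    unfolding unital_subalgebra_def using coinvariants_subset sub one mult by auto
qed

text \<open>
  Choose a representation of \<open>\<Delta>(h)\<close> with independent left factors and let \<open>f\<close> be dual to the left factor
  of \<open>b\<close>, so that \<open>b = f(h\<^sub>1)h\<^sub>2\<close>.  By coassociativity
  \<open>b\<^sub>1 \<otimes> b\<^sub>2z = f(h\<^sub>1)h\<^sub>2 \<otimes> h\<^sub>3z = f(h\<^sub>1)h\<^sub>2 \<otimes> z = b \<otimes> z\<close>.
\<close>

lemma coinvariants_left_coideal:
  assumes z: "z \<in> V" and h: "h \<in> coinvariants H z"
  shows "tensor_in (\<odot>) (\<Delta> h) V (coinvariants H z)"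
proof -
  have hV: "h \<in> V" using h coinvariants_subset by auto
  obtain ys where ys: "tensor_eq (\<odot>) (\<Delta> h) ys" "set ys \<subseteq> V \<times> V" "distinct (map fst ys)"
      "independent (fst ` set ys)"
    using tensor_independent_representation[OF carrier_subspace comult_closed[OF hV]] by auto
  have h_ys: "sw h B = tensor_sum ys B" if "bilin B" for B
    using ys that hV by (intro tensor_eq_sum[OF _ carrier_subspace]) (auto simp: comult_closed)
  have "b \<in> coinvariants H z" if ab: "(a, b) \<in> set ys" for a b
  proof (rule coinvariantsI)
    show "b \<in> V" using ys(2) ab by auto
    obtain f where f: "functional f" "tensor_sum ys (\<lambda>u v. f u \<odot> v) = b"
      using dual_functional[OF ys(4,3) ab] by blast
    note lf = linear_on_functional[OF f(1)]
    have b: "g b = sw h (\<lambda>u v. f u \<odot> g v)" if g: "lin g" for g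
    proof -
      have "g b = g (sw h (\<lambda>u v. f u \<odot> v))" using f h_ys[OF bilin_functional[OF f(1)]] by simp
      also have "\<dots> = sw h (\<lambda>u v. g (f u \<odot> v))"
        using g hV by (intro linear_on_tensor_sum_apply[OF carrier_subspace]) (auto simp: closed)
      also have "\<dots> = sw h (\<lambda>u v. f u \<odot> g v)"
        using g hV by (intro tensor_sum_cong) (auto simp: linear_on_scale closed)
      finally show ?thesis .
    qed
    fix g assume g: "functional g"
    note lg = linear_on_functional[OF g]
    have "sw b (\<lambda>c d. g c \<odot> (d \<cdot> z)) = sw h (\<lambda>u v. f u \<odot> sw v (\<lambda>c d. g c \<odot> (d \<cdot> z)))"
      using z by (intro b lin_intros lg) (auto simp: closed)
    also have "\<dots> = sw h (\<lambda>u v. sw v (\<lambda>c d. f u \<odot> (g c \<odot> (d \<cdot> z))))"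
      by (simp only: scale_tensor_sum)
    also have "\<dots> = sw h (\<lambda>u d. sw u (\<lambda>a c. f a \<odot> (g c \<odot> (d \<cdot> z))))"
      using z hV by (intro sw_coassoc[symmetric] lin_intros lf lg) (auto simp: closed)
    also have "\<dots> = sw h (\<lambda>a c. f a \<odot> (g c \<odot> z))"
      using z hV by (intro coinvariants_sum[OF h z, where B = "\<lambda>u v. sw u (\<lambda>a c. f a \<odot> (g c \<odot> v))"] lin_intros lf lg)
        (auto simp: closed)
    also have "\<dots> = g b \<odot> z"
      by (intro b[of "\<lambda>c. g c \<odot> z", symmetric] lg lin_intros)
    finally show "sw b (\<lambda>c d. g c \<odot> (d \<cdot> z)) = g b \<odot> z" .
  qed
  then have "set ys \<subseteq> V \<times> coinvariants H z" using ys(2) by auto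
  with ys(1) show ?thesis by (auto simp: tensor_in_def)
qed

lemma coinvariants_left_coideal_subalgebra:
  "z \<in> V \<Longrightarrow> left_coideal_subalgebra H (coinvariants H z)"
  by (simp add: left_coideal_subalgebra_def coinvariants_unital_subalgebra coinvariants_left_coideal)

lemma coinvariants_mult:
  assumes z: "z \<in> V" and n: "n \<in> coinvariants H z"
  shows "n \<cdot> z = \<epsilon> n \<odot> z"
proof -
  have nV: "n \<in> V" using n coinvariants_subset by auto
  have "n \<cdot> z = sw n (\<lambda>a b. \<epsilon> a \<odot> (b \<cdot> z))"
    using nV z by (intro sw_counit_left[symmetric] lin_intros) auto
  also have "\<dots> = \<epsilon> n \<odot> z"
    using nV z by (intro coinvariants_sum[OF n z, where B = "\<lambda>u v. \<epsilon> u \<odot> v"] lin_intros) auto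
  finally show ?thesis .
qed

lemma coinvariants_unit: "coinvariants H \<one> = scalars H"
proof
  show "coinvariants H \<one> \<subseteq> scalars H"
  proof
    fix x assume x: "x \<in> coinvariants H \<one>"
    then have "x \<in> V" using coinvariants_subset by auto
    then have "x = \<epsilon> x \<odot> \<one>" using coinvariants_mult[OF unit_closed x] by (simp add: unit_right)
    then show "x \<in> scalars H" unfolding scalars_def by blast
  qed
  note U = unital_subalgebraD[OF coinvariants_unital_subalgebra[OF unit_closed]]
  show "scalars H \<subseteq> coinvariants H \<one>"
    unfolding scalars_def using U(3) subspace_scale[OF U(2)] by auto
qed

lemma hopf_integral_eq:
  assumes "is_integral H N L" "N \<subseteq> V"
  shows "hopf_integral H N = L"
  unfolding hopf_integral_def
proof (rule the_equality[of "is_integral H N", OF assms(1)])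
  fix M assume M: "is_integral H N M"
  have "L \<cdot> M = \<epsilon> L \<odot> M" "L \<cdot> M = \<epsilon> M \<odot> L" "\<epsilon> L = 1" "\<epsilon> M = 1"
    using M assms unfolding is_integral_def by blast+
  then show "M = L" by simp
qed

text \<open>
  Under \<open>z\<close> the element \<open>b\<close> moves past \<open>S(a\<^sub>2)\<close>, and \<open>a\<^sub>1S(a\<^sub>2) = \<epsilon>(a)1\<close>.
\<close>

lemma left_adjoint_trivial:
  assumes a: "a \<in> V" and b: "b \<in> V" and z: "z \<in> V"
    and comm: "\<And>y. y \<in> V \<Longrightarrow> (b \<cdot> y) \<cdot> z = (y \<cdot> b) \<cdot> z"
  shows "left_adjoint H a b \<cdot> z = \<epsilon> a \<odot> (b \<cdot> z)"
proof -
  have "left_adjoint H a b \<cdot> z = sw a (\<lambda>x y. x \<cdot> b \<cdot> S y) \<cdot> z"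
    by (simp add: left_adjoint_def tensor_sum_def)
  also have "\<dots> = sw a (\<lambda>x y. (x \<cdot> b \<cdot> S y) \<cdot> z)"
    using a b z by (intro linear_on_tensor_sum_apply[OF carrier_subspace, where g = "\<lambda>x. x \<cdot> z"] lin_intros)
      (auto simp: closed)
  also have "\<dots> = sw a (\<lambda>x y. (x \<cdot> S y) \<cdot> (b \<cdot> z))"
  proof (rule tensor_sum_cong)
    fix x y assume "(x, y) \<in> set (\<Delta> a)"
    then have m: "x \<in> V" "S y \<in> V" using a by (auto simp: closed)
    have "(x \<cdot> b \<cdot> S y) \<cdot> z = x \<cdot> ((b \<cdot> S y) \<cdot> z)" using m b z by (simp add: mult_assoc closed)
    also have "\<dots> = x \<cdot> ((S y \<cdot> b) \<cdot> z)" using comm m by simp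
    also have "\<dots> = (x \<cdot> S y) \<cdot> (b \<cdot> z)" using m b z by (simp add: mult_assoc closed)
    finally show "(x \<cdot> b \<cdot> S y) \<cdot> z = (x \<cdot> S y) \<cdot> (b \<cdot> z)" .
  qed
  also have "\<dots> = \<epsilon> a \<odot> (\<one> \<cdot> (b \<cdot> z))"
    using a b z by (intro sw_antipode_right[where g = "\<lambda>t. t \<cdot> (b \<cdot> z)"] lin_intros) (auto simp: closed)
  finally show ?thesis using b z by (simp add: unit_left closed)
qed

end

section \<open>Central idempotents that cut out the central quotients\<close>

text \<open>
  The induction hypothesis: \<open>\<pi>\<close> is a surjective homomorphism of Hopf algebras with kernel \<open>H(1 - e)\<close>, so
  that \<open>R\<close> is a copy of \<open>He\<close>.  The last assumption is \<open>\<Delta>(e)(1 \<otimes> e) = e \<otimes> e\<close>.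
\<close>

locale idempotent_projection = hopf_algebra H
  for H :: "('k::field, 'a::ab_group_add) hopf" (structure) +
  fixes R :: "('k, 'a) hopf" and \<pi> :: "'a \<Rightarrow> 'a" and e :: 'a
  assumes R_hopf: "hopf_algebra R" and R_semisimple: "hopf_semisimple R"
    and R_scale: "hscale R = hscale H"
    and pi_linear: "Vector_Spaces.linear (\<odot>) (\<odot>) \<pi>"
    and pi_surj: "\<pi> ` V = hcarrier R"
    and pi_mult: "\<lbrakk>x \<in> V; y \<in> V\<rbrakk> \<Longrightarrow> \<pi> (x \<cdot> y) = \<pi> x \<cdot>\<^bsub>R\<^esub> \<pi> y"
    and pi_unit: "\<pi> \<one> = \<one>\<^bsub>R\<^esub>"
    and pi_counit: "x \<in> V \<Longrightarrow> \<epsilon>\<^bsub>R\<^esub> (\<pi> x) = \<epsilon> x"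
    and pi_comult: "x \<in> V \<Longrightarrow> tensor_eq (\<odot>) (\<Delta>\<^bsub>R\<^esub> (\<pi> x)) (map (\<lambda>(a, b). (\<pi> a, \<pi> b)) (\<Delta> x))"
    and e_V: "e \<in> V" and e_central: "x \<in> V \<Longrightarrow> e \<cdot> x = x \<cdot> e" and e_idem: "e \<cdot> e = e"
    and e_counit: "\<epsilon> e = 1" and pi_kernel: "x \<in> V \<Longrightarrow> \<pi> x = 0 \<longleftrightarrow> x \<cdot> e = 0"
    and e_coinvariant: "e \<in> coinvariants H e"
begin

sublocale R: hopf_algebra R
  by (rule R_hopf)

lemma pi_add: "\<pi> (x + y) = \<pi> x + \<pi> y"
  and pi_scale: "\<pi> (c \<odot> x) = c \<odot> \<pi> x"
  and pi_diff: "\<pi> (x - y) = \<pi> x - \<pi> y"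
proof -
  interpret vector_space_pair "(\<odot>)" "(\<odot>)" by unfold_locales
  show "\<pi> (x + y) = \<pi> x + \<pi> y" "\<pi> (c \<odot> x) = c \<odot> \<pi> x" "\<pi> (x - y) = \<pi> x - \<pi> y"
    using pi_linear by (simp_all add: linear_add linear_scale linear_diff)
qed

lemma pi_R: "x \<in> V \<Longrightarrow> \<pi> x \<in> hcarrier R"
  using pi_surj by blast

lemma pi_eq_iff: "x \<in> V \<Longrightarrow> y \<in> V \<Longrightarrow> \<pi> x = \<pi> y \<longleftrightarrow> x \<cdot> e = y \<cdot> e"
  using pi_kernel[of "x - y"] by (simp add: pi_diff mult_diff_left e_V closed)

lemma pi_e: "\<pi> e = \<one>\<^bsub>R\<^esub>"
  using pi_eq_iff[OF e_V unit_closed] by (simp add: e_idem unit_left e_V pi_unit)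

lemma R_comult_sum:
  assumes x: "x \<in> V" and B: "R.bilin B"
  shows "R.sw (\<pi> x) B = sw x (\<lambda>a b. B (\<pi> a) (\<pi> b))"
proof -
  have "R.sw (\<pi> x) B = tensor_sum (map (\<lambda>(a, b). (\<pi> a, \<pi> b)) (\<Delta> x)) B"
    using x B pi_comult[OF x] comult_closed[OF x] R.comult_closed[OF pi_R[OF x]]
    by (intro R.tensor_eq_sum[OF _ R.carrier_subspace B]) (auto simp: R_scale intro: pi_R)
  then show ?thesis by (simp add: tensor_sum_map)
qed

text \<open>
  The isomorphism of \<open>R\<close> with \<open>He\<close>.
\<close>

lemma lift_exists:
  obtains \<sigma> where "R.lin \<sigma>" "\<And>x. x \<in> V \<Longrightarrow> \<sigma> (\<pi> x) = x \<cdot> e"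
proof -
  define \<sigma> where "\<sigma> u = (SOME x. x \<in> V \<and> \<pi> x = u) \<cdot> e" for u
  have s: "\<sigma> (\<pi> x) = x \<cdot> e" if x: "x \<in> V" for x
  proof -
    have "(SOME y. y \<in> V \<and> \<pi> y = \<pi> x) \<in> V \<and> \<pi> (SOME y. y \<in> V \<and> \<pi> y = \<pi> x) = \<pi> x"
      by (rule someI[of "\<lambda>y. y \<in> V \<and> \<pi> y = \<pi> x" x]) (simp add: x)
    then show ?thesis unfolding \<sigma>_def using pi_eq_iff[OF _ x] by blast
  qed
  have "R.lin \<sigma>"
  proof (rule R.linear_onI)
    fix u v assume "u \<in> hcarrier R" "v \<in> hcarrier R"
    then obtain x y where xy: "x \<in> V" "y \<in> V" "u = \<pi> x" "v = \<pi> y" unfolding pi_surj[symmetric] by blast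
    have "\<sigma> (\<pi> (x + y)) = \<sigma> (\<pi> x) + \<sigma> (\<pi> y)"
      using xy(1,2) by (subst (1 2 3) s) (simp_all add: closed mult_add_left e_V)
    then show "\<sigma> (u + v) = \<sigma> u + \<sigma> v" using xy by (simp add: pi_add)
  next
    fix c u assume "u \<in> hcarrier R"
    then obtain x where x: "x \<in> V" "u = \<pi> x" unfolding pi_surj[symmetric] by blast
    have "\<sigma> (\<pi> (c \<odot> x)) = c \<odot> \<sigma> (\<pi> x)"
      using x(1) by (subst (1 2) s) (simp_all add: closed mult_scale_left e_V)
    then show "\<sigma> (c \<odot>\<^bsub>R\<^esub> u) = c \<odot>\<^bsub>R\<^esub> \<sigma> u" using x by (simp add: pi_scale R_scale)
  qed
  with s that show ?thesis by blast
qed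

lemma integral_coinvariants: "is_integral H (coinvariants H e) e"
  unfolding is_integral_def
proof (intro conjI ballI)
  fix n assume n: "n \<in> coinvariants H e"
  show "n \<cdot> e = \<epsilon> n \<odot> e" by (rule coinvariants_mult[OF e_V n])
  then show "e \<cdot> n = \<epsilon> n \<odot> e" using e_central[of n] subsetD[OF coinvariants_subset n] by simp
qed (simp_all add: e_counit e_coinvariant)

text \<open>
  If \<open>R\<close> consists of scalars, then \<open>be = \<epsilon>(b)e\<close> for all \<open>b\<close>.
\<close>

lemma coinvariants_of_scalars:
  assumes "hcarrier R = scalars R"
  shows "coinvariants H e = V"
proof
  show "V \<subseteq> coinvariants H e"
  proof
    have mult_e: "b \<cdot> e = \<epsilon> b \<odot> e" if b: "b \<in> V" for b
    proof -
      obtain c where c: "\<pi> b = c \<odot> \<one>\<^bsub>R\<^esub>"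
        using assms pi_R[OF b] by (auto simp: scalars_def R_scale)
      then have pb: "\<pi> b = \<pi> (c \<odot> \<one>)" by (simp add: pi_scale pi_unit)
      then have "\<epsilon> b = c" using pi_counit[OF b] pi_counit[of "c \<odot> \<one>"]
        by (simp add: closed counit_scale counit_unit)
      moreover have "b \<cdot> e = (c \<odot> \<one>) \<cdot> e" using pb b by (subst (asm) pi_eq_iff) (simp_all add: closed)
      ultimately show ?thesis by (simp add: mult_scale_left unit_left e_V closed)
    qed
    fix x assume x: "x \<in> V"
    show "x \<in> coinvariants H e"
    proof (rule coinvariantsI[OF x])
      fix f assume f: "functional f"
      have "sw x (\<lambda>a b. f a \<odot> (b \<cdot> e)) = sw x (\<lambda>a b. \<epsilon> b \<odot> (f a \<odot> e))"
        using x by (intro tensor_sum_cong) (auto simp: mult_e closed mult.commute)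
      also have "\<dots> = f x \<odot> e"
        using x by (intro sw_counit_right linear_on_functional[OF f] lin_intros)
      finally show "sw x (\<lambda>a b. f a \<odot> (b \<cdot> e)) = f x \<odot> e" .
    qed
  qed
qed (rule coinvariants_subset)

text \<open>
  The integral \<open>s\<close> of the Hopf center of \<open>R\<close> is lifted to the unique element \<open>e'\<close> of \<open>He\<close> above it.
  Because \<open>He\<close> is a direct factor isomorphic to \<open>R\<close>, centrality and idempotence of \<open>s\<close> pass to \<open>e'\<close>.
\<close>

lemma central_quotient_step:
  shows "\<exists>e'. idempotent_projection H (hopf_quotient R (hopf_center R))
      (\<lambda>x. quotient_proj R (hopf_center R) (\<pi> x)) e' \<and>
    coinvariants H e \<subseteq> coinvariants H e' \<and>
    (\<forall>b\<in>coinvariants H e'. \<forall>y\<in>V. (b \<cdot> y) \<cdot> e = (y \<cdot> b) \<cdot> e)"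
proof -
  let ?K = "hopf_center R"
  have K_hopf: "hopf_subalgebra R ?K" and K_central: "?K \<subseteq> center_of R (hcarrier R)"
    by (rule R.hopf_center_hopf_subalgebra R.hopf_center_central)+
  have K_unital: "unital_subalgebra R ?K" using K_hopf by (simp add: hopf_subalgebra_def)
  obtain s where s: "s \<in> ?K" "\<epsilon>\<^bsub>R\<^esub> s = 1" "\<And>k. k \<in> ?K \<Longrightarrow> k \<cdot>\<^bsub>R\<^esub> s = \<epsilon>\<^bsub>R\<^esub> k \<odot>\<^bsub>R\<^esub> s"
    using R.central_subalgebra_integral[OF R_semisimple K_unital K_central] by blast
  interpret C: central_hopf_integral R ?K s
    by unfold_locales (use K_hopf K_central s in auto)
  have "s \<in> \<pi> ` V" using C.s_V pi_surj by simp
  then obtain x where x: "x \<in> V" "\<pi> x = s" by auto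
  define e' where "e' = x \<cdot> e"
  have e'_V: "e' \<in> V" using x e_V by (simp add: e'_def closed)
  have pi_e': "\<pi> e' = s" using x e_V by (simp add: e'_def pi_mult pi_e R.unit_right C.s_V)
  have e'_e: "e' \<cdot> e = e'" using x e_V by (simp add: e'_def mult_assoc e_idem)
  have e_e': "e \<cdot> e' = e'" using e_central[OF e'_V] e'_e by simp
  have mult_e'_e: "(y \<cdot> e') \<cdot> e = y \<cdot> e'" if "y \<in> V" for y
    using that e'_V e_V by (simp add: mult_assoc e'_e)
  have e'_mult_e: "(e' \<cdot> y) \<cdot> e = e' \<cdot> y" if y: "y \<in> V" for y
  proof -
    have "(e' \<cdot> y) \<cdot> e = e' \<cdot> (e \<cdot> y)" using y e'_V e_V by (simp add: mult_assoc e_central)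
    also have "\<dots> = e' \<cdot> y" using y e'_V e_V by (simp add: mult_assoc[symmetric] e'_e)
    finally show ?thesis .
  qed
  have e'_central: "e' \<cdot> y = y \<cdot> e'" if y: "y \<in> V" for y
  proof -
    have "\<pi> (e' \<cdot> y) = \<pi> (y \<cdot> e')"
      using y e'_V pi_R[OF y] by (simp add: pi_mult pi_e' C.K_commutes[OF s(1)])
    then have "(e' \<cdot> y) \<cdot> e = (y \<cdot> e') \<cdot> e" using y e'_V by (subst (asm) pi_eq_iff) (simp_all add: closed)
    then show ?thesis using y by (simp add: mult_e'_e e'_mult_e)
  qed
  have e'_idem: "e' \<cdot> e' = e'"
  proof -
    have "\<pi> (e' \<cdot> e') = \<pi> e'" using e'_V by (simp add: pi_mult pi_e' C.s_idem)
    then have "(e' \<cdot> e') \<cdot> e = e' \<cdot> e" using e'_V by (subst (asm) pi_eq_iff) (simp_all add: closed)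
    then show ?thesis using e'_V by (simp add: mult_e'_e e'_e)
  qed
  have e'_counit: "\<epsilon> e' = 1" using pi_counit[OF e'_V] pi_e' s(2) by simp
  \<comment> \<open>In \<open>\<Delta>(e')(1 \<otimes> e') = \<Delta>(e')\<Delta>(e)(1 \<otimes> ee')\<close> the coinvariance of \<open>e\<close> replaces \<open>\<Delta>(e)(1 \<otimes> e)\<close> by \<open>e \<otimes> e\<close>.
    What remains is an equation in \<open>He \<otimes> He\<close>, namely the image under \<open>\<sigma> \<otimes> \<sigma>\<close> of the coinvariance of \<open>s\<close>.\<close>
  have e'_coinvariant: "e' \<in> coinvariants H e'"
  proof (rule coinvariantsI[OF e'_V])
    fix f assume f: "functional f"
    note lf = linear_on_functional[OF f]
    obtain \<sigma> where \<sigma>: "R.lin \<sigma>" "\<And>x. x \<in> V \<Longrightarrow> \<sigma> (\<pi> x) = x \<cdot> e" using lift_exists by blast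
    have bil: "R.bilin (\<lambda>u v. f (\<sigma> u) \<odot> \<sigma> v)"
      using \<sigma>(1) by (auto simp: R.bilinear_on_def R.linear_on_def bilinear_on_def linear_on_def R_scale functional_add[OF f]
          functional_scale[OF f] scale_left_distrib scale_right_distrib scale_left_commute)
    have bil': "R.bilin (\<lambda>u v. f (\<sigma> u) \<odot> \<sigma> (v \<cdot>\<^bsub>R\<^esub> s))"
      using bil C.s_V by (auto simp: R.bilinear_on_def R.linear_on_def bilinear_on_def linear_on_def R.closed_rules R.mult_add_left R.mult_scale_left)
    have Bz: "bilin (\<lambda>a b. f a \<odot> (b \<cdot> e'))"
      using e'_V by (intro lin_intros lf) auto
    have "sw e' (\<lambda>a b. f a \<odot> (b \<cdot> e')) = sw (e' \<cdot> e) (\<lambda>a b. f a \<odot> (b \<cdot> e'))" by (simp add: e'_e)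
    also have "\<dots> = sw e' (\<lambda>a b. sw e (\<lambda>c d. f (a \<cdot> c) \<odot> ((b \<cdot> d) \<cdot> e')))"
      by (rule sw_mult[OF Bz e'_V e_V])
    also have "\<dots> = sw e' (\<lambda>a b. sw e (\<lambda>c d. f (a \<cdot> c) \<odot> ((b \<cdot> (d \<cdot> e)) \<cdot> e')))"
      using e'_V e_V by (intro tensor_sum_cong) (simp add: mult_assoc closed e_e')
    also have "\<dots> = sw e' (\<lambda>a b. f (a \<cdot> e) \<odot> ((b \<cdot> e) \<cdot> e'))"
      using e'_V e_V
      by (intro tensor_sum_cong lin_intros lf
          coinvariants_sum[OF e_coinvariant e_V, where B = "\<lambda>c d. f (_ \<cdot> c) \<odot> ((_ \<cdot> d) \<cdot> e')"])
        (auto simp: closed)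
    also have "\<dots> = sw e' (\<lambda>a b. f (\<sigma> (\<pi> a)) \<odot> \<sigma> (\<pi> b \<cdot>\<^bsub>R\<^esub> s))"
    proof (rule tensor_sum_cong)
      fix a b assume "(a, b) \<in> set (\<Delta> e')"
      then have m: "a \<in> V" "b \<in> V" using e'_V by (auto simp: closed)
      have "\<sigma> (\<pi> b \<cdot>\<^bsub>R\<^esub> s) = \<sigma> (\<pi> (b \<cdot> e'))" using m e'_V by (simp add: pi_mult pi_e')
      also have "\<dots> = (b \<cdot> e') \<cdot> e" using m e'_V by (intro \<sigma>(2)) (simp add: closed)
      also have "\<dots> = (b \<cdot> e) \<cdot> e'" using m e'_V e_V by (simp add: mult_assoc e'_e e_e')
      finally show "f (a \<cdot> e) \<odot> ((b \<cdot> e) \<cdot> e') = f (\<sigma> (\<pi> a)) \<odot> \<sigma> (\<pi> b \<cdot>\<^bsub>R\<^esub> s)"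
        using \<sigma>(2)[OF m(1)] by simp
    qed
    also have "\<dots> = R.sw (\<pi> e') (\<lambda>u v. f (\<sigma> u) \<odot> \<sigma> (v \<cdot>\<^bsub>R\<^esub> s))"
      by (rule R_comult_sum[OF e'_V bil', symmetric])
    also have "\<dots> = f (\<sigma> s) \<odot> \<sigma> s" unfolding pi_e' by (rule C.sw_s[OF bil])
    also have "\<dots> = f e' \<odot> e'" using \<sigma>(2)[OF e'_V] by (simp add: pi_e' e'_e)
    finally show "sw e' (\<lambda>a b. f a \<odot> (b \<cdot> e')) = f e' \<odot> e'" .
  qed
  have p_lin: "Vector_Spaces.linear (\<odot>) (\<odot>) C.p" using C.p_linear by (simp add: R_scale)
  have ip: "idempotent_projection H C.Q (\<lambda>x. C.p (\<pi> x)) e'"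
  proof (intro idempotent_projection.intro idempotent_projection_axioms.intro, goal_cases)
    case 1 show ?case by unfold_locales
  next case 2 show ?case by (rule C.Q_hopf)
  next case 3 show ?case by (rule C.Q_semisimple[OF R_semisimple])
  next case 4 show ?case by (simp add: C.Q_simps R_scale)
  next case 5 show ?case
      unfolding Vector_Spaces.linear_iff
      using vector_space_axioms C.p_add C.p_scale by (simp add: pi_add pi_scale R_scale)
  next case 6 show ?case unfolding C.Q_simps pi_surj[symmetric] by (simp add: image_image)
  next case (7 x y) then show ?case by (simp add: C.Q_simps pi_mult C.p_mult_left C.p_mult_right pi_R C.p_V)
  next case 8 show ?case by (simp add: C.Q_simps pi_unit)
  next case (9 x) then show ?case by (simp add: C.Q_simps C.counit_p pi_R pi_counit)
  next case (10 x)
    have pp: "map (\<lambda>(a, b). (C.p (\<pi> a), C.p (\<pi> b))) (\<Delta> x) = C.pp (map (\<lambda>(a, b). (\<pi> a, \<pi> b)) (\<Delta> x))"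
      by (simp add: case_prod_unfold)
    show ?case unfolding C.Q_simps pp
      by (rule tensor_eq.trans[OF C.comult_p[OF pi_R[OF 10], unfolded R_scale] tensor_eq_map[OF p_lin pi_comult[OF 10]]])
  next case 11 show ?case by (rule e'_V)
  next case (12 x) then show ?case by (rule e'_central)
  next case 13 show ?case by (rule e'_idem)
  next case 14 show ?case by (rule e'_counit)
  next case (15 x)
    have "C.p (\<pi> x) = 0 \<longleftrightarrow> \<pi> x \<cdot>\<^bsub>R\<^esub> s = 0" by (rule C.p_eq_0_iff[OF pi_R[OF 15]])
    also have "\<dots> \<longleftrightarrow> \<pi> (x \<cdot> e') = 0" using 15 e'_V by (simp add: pi_mult pi_e')
    also have "\<dots> \<longleftrightarrow> x \<cdot> e' = 0" using 15 e'_V by (simp add: pi_kernel closed mult_e'_e)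
    finally show ?case .
  next case 16 show ?case by (rule e'_coinvariant)
  qed
  have mono: "coinvariants H e \<subseteq> coinvariants H e'"
  proof
    fix y assume y: "y \<in> coinvariants H e"
    then have yV: "y \<in> V" using coinvariants_subset by auto
    show "y \<in> coinvariants H e'"
    proof (rule coinvariantsI[OF yV])
      fix f assume f: "functional f"
      have "sw y (\<lambda>a b. f a \<odot> (b \<cdot> e')) = sw y (\<lambda>a b. f a \<odot> ((b \<cdot> e) \<cdot> e'))"
        using yV e_V e'_V by (intro tensor_sum_cong) (simp add: mult_assoc closed e_e')
      also have "\<dots> = f y \<odot> (e \<cdot> e')"
        using yV e'_V
        by (intro coinvariants_sum[OF y e_V, where B = "\<lambda>u v. f u \<odot> (v \<cdot> e')"] lin_intros linear_on_functional[OF f])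
          auto
      finally show "sw y (\<lambda>a b. f a \<odot> (b \<cdot> e')) = f y \<odot> e'" by (simp add: e_e')
    qed
  qed
  \<comment> \<open>The image of \<open>b\<close> in \<open>R\<close> is coinvariant for \<open>s\<close>, so it lies in the Hopf center of \<open>R\<close>.\<close>
  have comm: "(b \<cdot> y) \<cdot> e = (y \<cdot> b) \<cdot> e" if b: "b \<in> coinvariants H e'" and y: "y \<in> V" for b y
  proof -
    have bV: "b \<in> V" using b coinvariants_subset by auto
    have "\<pi> b \<in> coinvariants R s"
    proof (rule R.coinvariantsI[OF pi_R[OF bV]])
      fix f assume "R.functional f"
      then have f: "functional f" by (simp add: R_scale)
      have bil: "R.bilin (\<lambda>u v. f u \<odot> (v \<cdot>\<^bsub>R\<^esub> s))"
        using C.s_V by (auto simp: R.bilinear_on_def R.linear_on_def bilinear_on_def linear_on_def R_scale functional_add[OF f]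
          functional_scale[OF f] scale_left_distrib scale_right_distrib scale_left_commute R.mult_add_left R.mult_scale_left
          R.mult_scale_left[unfolded R_scale])
      have "R.sw (\<pi> b) (\<lambda>u v. f u \<odot> (v \<cdot>\<^bsub>R\<^esub> s)) = sw b (\<lambda>u v. f (\<pi> u) \<odot> (\<pi> v \<cdot>\<^bsub>R\<^esub> s))"
        by (rule R_comult_sum[OF bV bil])
      also have "\<dots> = sw b (\<lambda>u v. f (\<pi> u) \<odot> \<pi> (v \<cdot> e'))"
        using bV e'_V by (intro tensor_sum_cong) (simp add: pi_mult pi_e' closed)
      also have "\<dots> = f (\<pi> b) \<odot> \<pi> e'"
        by (intro coinvariants_sum[OF b e'_V, where B = "\<lambda>u v. f (\<pi> u) \<odot> \<pi> v"] lin_intros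
            linear_on_functional[OF f] linear_on_comp[OF pi_linear])
      finally show "R.sw (\<pi> b) (\<lambda>u v. f u \<odot>\<^bsub>R\<^esub> (v \<cdot>\<^bsub>R\<^esub> s)) = f (\<pi> b) \<odot>\<^bsub>R\<^esub> s"
        by (simp add: R_scale pi_e')
    qed
    then have "\<pi> b \<in> ?K" using C.coinvariants_eq by simp
    then have "\<pi> (b \<cdot> y) = \<pi> (y \<cdot> b)"
      using C.K_commutes pi_R[OF y] bV y by (simp add: pi_mult)
    then show ?thesis using bV y by (subst (asm) pi_eq_iff) (simp_all add: closed)
  qed
  show ?thesis using ip mono comm unfolding C.Q_def C.p_def by blast
qed

end

lemma idempotent_projection_id:
  assumes "hopf_algebra H" "hopf_semisimple H"
  shows "idempotent_projection H H (\<lambda>x. x) \<one>\<^bsub>H\<^esub>"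
proof -
  interpret hopf_algebra H by fact
  show ?thesis
  proof (intro idempotent_projection.intro idempotent_projection_axioms.intro, goal_cases)
    case 1 show ?case by fact
  next case 2 show ?case by fact
  next case 3 show ?case by fact
  next case 4 show ?case by simp
  next case 5 show ?case unfolding Vector_Spaces.linear_iff using vector_space_axioms by simp
  next case (10 x) show ?case by (simp add: tensor_eq.refl)
  next case 16 show ?case
      using unital_subalgebraD(3)[OF coinvariants_unital_subalgebra[OF unit_closed]] .
  qed (simp_all add: unit_left unit_right closed counit_unit)
qed

section \<open>Nilpotent semisimple Hopf algebras are solvable\<close>

theorem corollary3p9:
  fixes H :: "('k::{alg_closed_field, field_char_0}, 'a::ab_group_add) hopf"
  assumes "hopf_algebra H"
    and "hopf_semisimple H"
    and "hopf_nilpotent H"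
  shows "hopf_solvable H"
proof -
  interpret hopf_algebra H by fact
  \<comment> \<open>The clause for \<open>n = 0\<close> makes the series start at the coinvariants for \<open>1\<close>, which are the scalars.\<close>
  let ?P = "\<lambda>n e. (\<exists>\<pi>. idempotent_projection H (central_quotient H n) \<pi> e) \<and> (n = 0 \<longrightarrow> e = \<one>\<^bsub>H\<^esub>)"
  let ?T = "\<lambda>e e'. coinvariants H e \<subseteq> coinvariants H e' \<and>
      (\<forall>b\<in>coinvariants H e'. \<forall>y\<in>V. (b \<cdot>\<^bsub>H\<^esub> y) \<cdot>\<^bsub>H\<^esub> e = (y \<cdot>\<^bsub>H\<^esub> b) \<cdot>\<^bsub>H\<^esub> e)"
  have "\<exists>E. \<forall>n. ?P n (E n) \<and> ?T (E n) (E (Suc n))"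
  proof (rule dependent_nat_choice)
    show "\<exists>e. ?P 0 e"
      using idempotent_projection_id[OF assms(1,2)] by auto
  next
    fix e n assume "?P n e"
    then obtain \<pi> where "idempotent_projection H (central_quotient H n) \<pi> e" by blast
    from idempotent_projection.central_quotient_step[OF this]
    show "\<exists>e'. ?P (Suc n) e' \<and> ?T e e'" by auto
  qed
  then obtain E where E_all: "\<forall>n. ?P n (E n) \<and> ?T (E n) (E (Suc n))" by (elim exE)
  have E: "\<exists>\<pi>. idempotent_projection H (central_quotient H n) \<pi> (E n)"
    and mono: "coinvariants H (E n) \<subseteq> coinvariants H (E (Suc n))" for n
    using E_all[rule_format, of n] by blast+
  have E0: "E 0 = \<one>\<^bsub>H\<^esub>" using E_all[rule_format, of 0] by blast
  have comm: "(b \<cdot>\<^bsub>H\<^esub> y) \<cdot>\<^bsub>H\<^esub> E n = (y \<cdot>\<^bsub>H\<^esub> b) \<cdot>\<^bsub>H\<^esub> E n"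
    if "b \<in> coinvariants H (E (Suc n))" "y \<in> V" for n b y
    using E_all[rule_format, of n] that by blast
  have E_V: "E n \<in> V" for n using E[of n] idempotent_projection.e_V by blast
  have E_central: "E n \<cdot>\<^bsub>H\<^esub> x = x \<cdot>\<^bsub>H\<^esub> E n" if "x \<in> V" for n x
    using E[of n] idempotent_projection.e_central that by blast
  have integral: "hopf_integral H (coinvariants H (E n)) = E n" for n
    using E[of n] idempotent_projection.integral_coinvariants hopf_integral_eq coinvariants_subset by blast
  have E_coinv: "E n \<in> coinvariants H (E n)" for n
    using E[of n] idempotent_projection.e_coinvariant by blast
  have series: "solvable_series H (\<lambda>n. coinvariants H (E n)) t" for t
    unfolding solvable_series_def integral
  proof (intro conjI allI impI ballI)
    show "left_coideal_subalgebra H (coinvariants H (E i))" for i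
      by (rule coinvariants_left_coideal_subalgebra[OF E_V])
    show "coinvariants H (E i) \<subseteq> coinvariants H (E (Suc i))" for i by (rule mono)
    show "E i \<in> center_of H (coinvariants H (E (Suc i)))" for i
      unfolding center_of_def using E_coinv[of i] mono[of i] E_central coinvariants_subset by blast
    show "left_adjoint H a b \<cdot>\<^bsub>H\<^esub> E i = \<epsilon>\<^bsub>H\<^esub> a \<odot>\<^bsub>H\<^esub> (b \<cdot>\<^bsub>H\<^esub> E i)"
      if "a \<in> coinvariants H (E (Suc i))" "b \<in> coinvariants H (E (Suc i))" for i a b
      using that coinvariants_subset E_V comm by (intro left_adjoint_trivial) auto
  qed
  obtain t where "hcarrier (central_quotient H t) = scalars (central_quotient H t)"
    using assms(3) by (auto simp: hopf_nilpotent_def)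
  then have "coinvariants H (E t) = hcarrier H"
    using E[of t] idempotent_projection.coinvariants_of_scalars by blast
  moreover have "coinvariants H (E 0) = scalars H" by (simp add: E0 coinvariants_unit)
  ultimately show ?thesis unfolding hopf_solvable_def using series by blast
qed

end
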